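(* Let $\mathcal H$ be a complex, separable, infinite-dimensional Hilbert space, let $T\in\mathcal B(\mathcal H)$ and let $n\ge2$ be an integer. Suppose that $T$ is $\textsc{j}_n^{[\textsc{s}]}$-stable, i.e. $T$ is similar to $J_n(T)$. Then: (a) $\sigma(T)=\mathbb T$ if $T$ is invertible; and (b) $\sigma(T)=\overline{\mathbb D}$ if $T$ is not invertible.
   Context: $\mathbb T=\{z\in\mathbb C:|z|=1\}$, $\mathbb D=\{z\in\mathbb C:|z|<1\}$; $\sigma(T)$ is the spectrum. For $T\in\mathcal B(\mathcal H)$ and $n\ge2$, $J_n(T)\in\mathcal B(\mathcal H^{(n)})$ (where $\mathcal H^{(n)}$ is the direct sum of $n$ copies of $\mathcal H$) is the $n\times n$ operator matrix with $I$ in each entry $(i,i+1)$, $1\le i\le n-1$, with $T$ in the entry $(n,1)$, and $0$ elsewhere. Operators $X,Y$ on Hilbert spaces are similar if $Y=S^{-1}XS$ for some bounded invertible operator $S$ (with bounded inverse) between the underlying spaces. *)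

theory Defs
  imports "HOL-Analysis.Analysis"
begin

class complex_vector = real_vector +
  fixes scaleC :: "complex \<Rightarrow> 'a \<Rightarrow> 'a" (infixr "*\<^sub>C" 75)
  assumes scaleC_add_right: "c *\<^sub>C (x + y) = c *\<^sub>C x + c *\<^sub>C y"
    and scaleC_add_left: "(c + d) *\<^sub>C x = c *\<^sub>C x + d *\<^sub>C x"
    and scaleC_scaleC: "c *\<^sub>C d *\<^sub>C x = (c * d) *\<^sub>C x"
    and scaleC_one: "1 *\<^sub>C x = x"
    and scaleR_scaleC: "r *\<^sub>R x = complex_of_real r *\<^sub>C x"

lemma vector_space_scaleC: "vector_space (scaleC :: complex \<Rightarrow> 'a::complex_vector \<Rightarrow> 'a)"
  by unfold_locales (simp_all add: scaleC_add_right scaleC_add_left scaleC_scaleC scaleC_one)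

text \<open>Positive definiteness, and the fact that the norm is induced by \<open>cinner\<close>, are contained in
  the last axiom: \<open>cinner x x\<close> is real by symmetry, so it equals \<open>inner x x\<close>, which is the
  square of the norm by the axioms of \<open>real_inner\<close>.\<close>

class complex_inner = complex_vector + real_inner +
  fixes cinner :: "'a \<Rightarrow> 'a \<Rightarrow> complex"
  assumes cinner_commute: "cinner x y = cnj (cinner y x)"
    and cinner_add_left: "cinner (x + y) z = cinner x z + cinner y z"
    and cinner_scaleC_left: "cinner (c *\<^sub>C x) y = c * cinner x y"
    and inner_eq_Re_cinner: "inner x y = Re (cinner x y)"

lemma cinner_self: "cinner x x = complex_of_real ((norm (x :: 'a::complex_inner))\<^sup>2)"
proof -
  have "Im (cinner x x) = 0"
    using arg_cong[OF cinner_commute[of x x], of Im] by simp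
  then show ?thesis
    by (simp add: complex_eq_iff power2_norm_eq_inner inner_eq_Re_cinner)
qed

class complex_hilbert = complex_inner + complete_space

text \<open>The Hilbert space direct sum of finitely many copies of a space is \<open>'a ^ 'n\<close>, whose
  library norm is the Euclidean one.\<close>

instantiation vec :: (complex_vector, finite) complex_vector
begin

definition scaleC_vec :: "complex \<Rightarrow> 'a ^ 'b \<Rightarrow> 'a ^ 'b" where
  "scaleC_vec c x = (\<chi> i. c *\<^sub>C (x $ i))"

instance
  by standard (simp_all add: scaleC_vec_def vec_eq_iff scaleC_add_right scaleC_add_left
      scaleC_scaleC scaleC_one scaleR_scaleC)

end

instantiation vec :: (complex_inner, finite) complex_inner
begin

definition cinner_vec :: "'a ^ 'b \<Rightarrow> 'a ^ 'b \<Rightarrow> complex" where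
  "cinner_vec x y = (\<Sum>i\<in>UNIV. cinner (x $ i) (y $ i))"

instance
proof
  fix x y z :: "'a ^ 'b" and c :: complex
  show "cinner x y = cnj (cinner y x)"
    unfolding cinner_vec_def cnj_sum by (rule sum.cong[OF refl cinner_commute])
  show "cinner (x + y) z = cinner x z + cinner y z"
    by (simp add: cinner_vec_def cinner_add_left sum.distrib)
  show "cinner (c *\<^sub>C x) y = c * cinner x y"
    by (simp add: cinner_vec_def scaleC_vec_def cinner_scaleC_left sum_distrib_left)
  show "inner x y = Re (cinner x y)"
    by (simp add: cinner_vec_def inner_vec_def inner_eq_Re_cinner)
qed

end

instance vec :: (complex_hilbert, finite) complex_hilbert ..

definition infinite_dimensional :: "'a::complex_vector itself \<Rightarrow> bool" where
  "infinite_dimensional _ \<longleftrightarrow>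
     \<not> (\<exists>B :: 'a set. finite B \<and> module.span scaleC B = UNIV)"

definition bounded_clinear :: "('a::complex_inner \<Rightarrow> 'b::complex_inner) \<Rightarrow> bool" where
  "bounded_clinear A \<longleftrightarrow> bounded_linear A \<and> (\<forall>c x. A (c *\<^sub>C x) = c *\<^sub>C A x)"

definition bounded_inverse ::
    "('a::complex_inner \<Rightarrow> 'b::complex_inner) \<Rightarrow> ('b \<Rightarrow> 'a) \<Rightarrow> bool" where
  "bounded_inverse A B \<longleftrightarrow>
     bounded_clinear A \<and> bounded_clinear B \<and> B \<circ> A = id \<and> A \<circ> B = id"

definition invertible_operator :: "('a::complex_inner \<Rightarrow> 'b::complex_inner) \<Rightarrow> bool" where
  "invertible_operator A \<longleftrightarrow> (\<exists>B. bounded_inverse A B)"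

definition spectrum :: "('a::complex_inner \<Rightarrow> 'a) \<Rightarrow> complex set" where
  "spectrum T = {z. \<not> invertible_operator (\<lambda>x. T x - z *\<^sub>C x)}"

definition similar_operators ::
    "('a::complex_inner \<Rightarrow> 'a) \<Rightarrow> ('b::complex_inner \<Rightarrow> 'b) \<Rightarrow> bool" where
  "similar_operators X Y \<longleftrightarrow>
     (\<exists>(S :: 'b \<Rightarrow> 'a) S'. bounded_inverse S S' \<and> Y = S' \<circ> X \<circ> S)"

text \<open>The number \<open>n\<close> of copies is \<open>CARD('n)\<close> for a finite linearly ordered index type \<open>'n\<close>;
  \<open>position\<close> is the order isomorphism of \<open>'n\<close> onto \<open>{1..n}\<close>.\<close>

definition position :: "'n::{finite,linorder} \<Rightarrow> nat" where
  "position i = card {..i}"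

lemma strict_mono_position: "strict_mono (position :: 'n::{finite,linorder} \<Rightarrow> nat)"
  by (auto simp: strict_mono_def position_def intro!: psubset_card_mono)

lemma bij_betw_position: "bij_betw (position :: 'n::{finite,linorder} \<Rightarrow> nat) UNIV {1..CARD('n)}"
proof -
  have inj: "inj (position :: 'n \<Rightarrow> nat)"
    using strict_mono_position by (rule strict_mono_imp_inj_on)
  have "position i \<in> {1..CARD('n)}" for i :: 'n
    by (auto simp: position_def card_gt_0_iff Suc_le_eq intro: card_mono)
  then have "range (position :: 'n \<Rightarrow> nat) = {1..CARD('n)}"
    by (intro card_subset_eq) (auto simp: card_image[OF inj])
  with inj show ?thesis by (simp add: bij_betw_def)
qed

definition operator_matrix :: "('n::finite \<Rightarrow> 'n \<Rightarrow> 'a \<Rightarrow> 'a) \<Rightarrow> 'a::real_vector ^ 'n \<Rightarrow> 'a ^ 'n" where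
  "operator_matrix M x = (\<chi> i. \<Sum>j\<in>UNIV. M i j (x $ j))"

definition J_operator ::
    "('a \<Rightarrow> 'a) \<Rightarrow> ('a::complex_inner, 'n::{finite,linorder}) vec \<Rightarrow> ('a, 'n) vec" where
  "J_operator T = operator_matrix (\<lambda>i j.
     if position j = position i + 1 then id
     else if position i = CARD('n) \<and> position j = 1 then T
     else (\<lambda>_. 0))"

lemma J_operator_nth:
  fixes x :: "('a::complex_inner, 'n::{finite,linorder}) vec"
  shows "position j = position i + 1 \<Longrightarrow> J_operator T x $ i = x $ j"
    and "position i = CARD('n) \<Longrightarrow> position j = 1 \<Longrightarrow> J_operator T x $ i = T (x $ j)"
proof -
  have eq: "position k = position l \<longleftrightarrow> k = l" for k l :: 'n
    using bij_betw_position by (auto simp: bij_betw_def inj_def)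
  have le: "position k \<le> CARD('n)" for k :: 'n
    by (auto simp: position_def intro: card_mono)
  show "J_operator T x $ i = x $ j" if "position j = position i + 1"
  proof -
    have "position i \<noteq> CARD('n)" using le[of j] that by simp
    moreover have "position k = position i + 1 \<longleftrightarrow> k = j" for k
      using that eq[of k j] by simp
    ultimately have "J_operator T x $ i = (\<Sum>k\<in>UNIV. if k = j then x $ k else 0)"
      unfolding J_operator_def operator_matrix_def vec_lambda_beta
      by (intro sum.cong) (auto simp: that)
    then show ?thesis by simp
  qed
  show "J_operator T x $ i = T (x $ j)" if "position i = CARD('n)" "position j = 1"
  proof -
    have "position k \<noteq> position i + 1" for k :: 'n using le[of k] that by simp
    moreover have "position k = 1 \<longleftrightarrow> k = j" for k
      using that eq[of k j] by simp
    ultimately have "J_operator T x $ i = (\<Sum>k\<in>UNIV. if k = j then T (x $ k) else 0)"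
      unfolding J_operator_def operator_matrix_def vec_lambda_beta
      by (intro sum.cong) (auto simp: that)
    then show ?thesis by simp
  qed
qed

end

theory Submission
  imports Defs "HOL-Complex_Analysis.Cauchy_Integral_Formula"
begin

text \<open>
  The \<open>n\<close>-th power of \<open>J\<^sub>n(T)\<close> is the direct sum of \<open>n\<close> copies of \<open>T\<close>, so stability makes the
  spectrum invariant under \<open>z \<mapsto> z\<^sup>n\<close> and under taking \<open>n\<close>-th roots. Being compact, the spectrum
  is then contained in the closed unit disc and invariant under rotations about \<open>0\<close>. If \<open>T\<close> is
  invertible, a point \<open>z\<close> of the open disc is excluded because its iterated powers tend to \<open>0\<close>,
  which is not in the spectrum.

  If \<open>T\<close> is not invertible and some \<open>z\<close> with \<open>0 < \<bar>z\<bar> < 1\<close> lies outside the spectrum, then so do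
  all the circles of radius \<open>s ^ (n ^ k)\<close>, \<open>s = \<bar>z\<bar>\<close>. The Riesz projection of each of them is nonzero
  (otherwise \<open>T\<close> would be invertible), so there are nonzero vectors whose orbits decay
  geometrically at arbitrarily fast rates; moreover \<open>\<bar>T\<^sup>m x\<bar> \<le> M s\<^sup>m \<bar>x\<bar>\<close> with a uniform \<open>M\<close> for such
  vectors. On the other hand the similarity lifts a vector of rate \<open>r\<^sup>n\<close> for \<open>T\<close> to a vector
  of rate \<open>r\<close>, and since \<open>J\<^sub>n(T)\<close> contains identity blocks, \<open>j\<close> such lifts give \<open>x \<noteq> 0\<close> with
  \<open>\<bar>T ^ (n ^ j) x\<bar> \<ge> C ^ -(j + 1) \<bar>x\<bar>\<close>. As \<open>n ^ j\<close> outgrows \<open>j\<close>, this is a contradiction.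
\<close>

section \<open>Bounded operators and resolvents\<close>

instance complex_hilbert \<subseteq> banach ..

interpretation scaleC: vector_space "scaleC :: complex \<Rightarrow> 'a::complex_vector \<Rightarrow> 'a"
  by (rule vector_space_scaleC)

lemma norm_scaleC: "norm (c *\<^sub>C x) = cmod c * norm (x :: 'a::complex_inner)"
proof -
  have "cinner (c *\<^sub>C x) (c *\<^sub>C x) = c * cnj (c * cinner x x)"
    by (metis cinner_commute cinner_scaleC_left)
  then have "complex_of_real ((norm (c *\<^sub>C x))\<^sup>2) = complex_of_real ((cmod c * norm x)\<^sup>2)"
    by (simp add: cinner_self complex_norm_square power_mult_distrib del: of_real_power)
  then show ?thesis
    by (metis norm_ge_zero of_real_eq_iff power2_eq_iff_nonneg zero_le_mult_iff)
qed

lemma bounded_bilinear_scaleC: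
  "bounded_bilinear (scaleC :: complex \<Rightarrow> 'a::complex_inner \<Rightarrow> 'a)"
proof
  show "\<exists>K. \<forall>a b. norm (a *\<^sub>C b :: 'a) \<le> norm a * norm b * K"
    by (rule exI[of _ 1]) (simp add: norm_scaleC)
qed (simp_all add: scaleC_add_left scaleC_add_right scaleR_scaleC scaleC_scaleC mult.commute
      scaleR_conv_of_real)

interpretation scaleC: bounded_bilinear "scaleC :: complex \<Rightarrow> 'a::complex_inner \<Rightarrow> 'a"
  by (rule bounded_bilinear_scaleC)

lemma bounded_clinear_imp_bounded_linear: "bounded_clinear A \<Longrightarrow> bounded_linear A"
  by (simp add: bounded_clinear_def)

lemma bounded_clinear_scaleC: "bounded_clinear A \<Longrightarrow> A (c *\<^sub>C x) = c *\<^sub>C A x"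
  by (simp add: bounded_clinear_def)

lemma bounded_clinear_diff: "bounded_clinear A \<Longrightarrow> A (x - y) = A x - A y"
  by (simp add: bounded_clinear_def linear_diff bounded_linear.linear)

lemma bounded_clinear_add: "bounded_clinear A \<Longrightarrow> A (x + y) = A x + A y"
  by (simp add: bounded_clinear_def linear_add bounded_linear.linear)

lemma bounded_clinear_0: "bounded_clinear A \<Longrightarrow> A 0 = 0"
  by (simp add: bounded_clinear_def linear_0 bounded_linear.linear)

lemma bounded_clinear_bound:
  assumes "bounded_clinear A"
  obtains K where "K > 0" "\<And>x. norm (A x) \<le> K * norm x"
  using bounded_linear.pos_bounded[of A] assms
  by (auto simp: bounded_clinear_def mult.commute)

lemma bounded_clinearI:
  assumes "\<And>x y. A (x + y) = A x + A y" "\<And>c x. A (c *\<^sub>C x) = c *\<^sub>C A x"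
    and "\<And>x. norm (A x) \<le> K * norm x"
  shows "bounded_clinear A"
  unfolding bounded_clinear_def
  using assms by (auto intro!: bounded_linear_intro[of A K] simp: scaleR_scaleC mult.commute)

lemma bounded_clinear_id: "bounded_clinear (\<lambda>x. x)"
  by (simp add: bounded_clinear_def bounded_linear_ident)

lemma bounded_clinear_compose:
  "bounded_clinear A \<Longrightarrow> bounded_clinear B \<Longrightarrow> bounded_clinear (\<lambda>x. A (B x))"
  by (auto simp: bounded_clinear_def intro: bounded_linear_compose)

lemma bounded_clinear_plus:
  "bounded_clinear A \<Longrightarrow> bounded_clinear B \<Longrightarrow> bounded_clinear (\<lambda>x. A x + B x)"
  by (auto simp: bounded_clinear_def scaleC_add_right intro: bounded_linear_add)

lemma bounded_clinear_minus:
  "bounded_clinear A \<Longrightarrow> bounded_clinear B \<Longrightarrow> bounded_clinear (\<lambda>x. A x - B x)"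
  by (auto simp: bounded_clinear_def scaleC.diff_right intro: bounded_linear_sub)

lemma bounded_clinear_scale: "bounded_clinear A \<Longrightarrow> bounded_clinear (\<lambda>x. c *\<^sub>C A x)"
  by (auto simp: bounded_clinear_def scaleC_scaleC mult.commute
      intro: bounded_linear_compose[OF scaleC.bounded_linear_right])

lemma bounded_clinear_funpow:
  "bounded_clinear (A :: 'a::complex_inner \<Rightarrow> 'a) \<Longrightarrow> bounded_clinear (A ^^ k)"
  by (induction k) (simp_all add: bounded_clinear_id id_def comp_def bounded_clinear_compose)

lemma bounded_clinear_sub_scale: "bounded_clinear T \<Longrightarrow> bounded_clinear (\<lambda>x. T x - z *\<^sub>C x)"
  by (intro bounded_clinear_minus bounded_clinear_scale bounded_clinear_id)

lemma bounded_clinear_vecI: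
  fixes f :: "'a::complex_inner \<Rightarrow> 'b::complex_inner ^ 'n::finite"
  assumes "\<And>i. bounded_clinear (\<lambda>x. f x $ i)"
  shows "bounded_clinear f"
proof -
  have "\<exists>K. \<forall>x. norm (f x $ i) \<le> K * norm x" for i
    using bounded_clinear_bound[OF assms[of i]] by metis
  then obtain K where K: "\<And>i x. norm (f x $ i) \<le> K i * norm x" by metis
  show ?thesis
  proof (rule bounded_clinearI)
    fix x
    have "norm (f x) \<le> (\<Sum>i\<in>UNIV. norm (f x $ i))"
      unfolding norm_vec_def by (rule L2_set_le_sum) simp
    also have "\<dots> \<le> (\<Sum>i\<in>UNIV. K i * norm x)" by (intro sum_mono K)
    finally show "norm (f x) \<le> (\<Sum>i\<in>UNIV. K i) * norm x" by (simp add: sum_distrib_right)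
  qed (simp_all add: vec_eq_iff scaleC_vec_def bounded_clinear_add[OF assms]
      bounded_clinear_scaleC[OF assms])
qed

lemma bounded_clinear_nth: "bounded_clinear (\<lambda>x. (x :: 'a::complex_inner ^ 'n::finite) $ i)"
  by (rule bounded_clinearI[where K = 1])
    (simp_all add: scaleC_vec_def Finite_Cartesian_Product.norm_nth_le)

text \<open>A left and a right inverse of the same map coincide, so regularity is asked of
  \<open>R\<close> alone, and the two may come from different formulas.\<close>

lemma bounded_inverseI:
  assumes "bounded_clinear A" "bounded_clinear R" "\<And>x. L (A x) = x" "\<And>x. A (R x) = x"
  shows "bounded_inverse A R"
proof -
  have "L x = R x" for x using assms(3)[of "R x"] assms(4)[of x] by simp
  then show ?thesis using assms by (simp add: bounded_inverse_def fun_eq_iff)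
qed

lemma bounded_inverseD:
  assumes "bounded_inverse A B"
  shows "bounded_clinear A" "bounded_clinear B" "\<And>x. B (A x) = x" "\<And>x. A (B x) = x"
  using assms by (auto simp: bounded_inverse_def fun_eq_iff)

lemma bounded_inverse_compose:
  assumes "bounded_inverse A A'" "bounded_inverse B B'"
  shows "bounded_inverse (\<lambda>x. A (B x)) (\<lambda>x. B' (A' x))"
  by (rule bounded_inverseI[where L = "\<lambda>x. B' (A' x)"])
    (simp_all add: bounded_inverseD[OF assms(1)] bounded_inverseD[OF assms(2)]
      bounded_clinear_compose[of A B] bounded_clinear_compose[of B' A'])

lemma invertible_operator_compose:
  "invertible_operator A \<Longrightarrow> invertible_operator B \<Longrightarrow> invertible_operator (\<lambda>x. A (B x))"
  unfolding invertible_operator_def by (blast intro: bounded_inverse_compose)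

lemma invertible_operator_scaleC:
  "c \<noteq> 0 \<Longrightarrow> invertible_operator (\<lambda>x :: 'a::complex_inner. c *\<^sub>C x)"
  unfolding invertible_operator_def
  by (intro exI[of _ "\<lambda>x. (1 / c) *\<^sub>C x"] bounded_inverseI[where L = "\<lambda>x. (1 / c) *\<^sub>C x"]
      bounded_clinear_scale bounded_clinear_id) (simp_all add: scaleC_scaleC scaleC_one)

lemma invertible_operator_bounded_below:
  assumes "invertible_operator A"
  obtains c where "c > 0" "\<And>x. c * norm x \<le> norm (A x)"
proof -
  obtain B where B: "bounded_inverse A B" using assms by (auto simp: invertible_operator_def)
  obtain K where K: "K > 0" "\<And>x. norm (B x) \<le> K * norm x"
    using bounded_clinear_bound[OF bounded_inverseD(2)[OF B]] by blast
  show ?thesis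
  proof (rule that)
    show "1 / K > 0" using K by simp
    show "1 / K * norm x \<le> norm (A x)" for x
      using K(2)[of "A x"] K(1) by (simp add: bounded_inverseD(3)[OF B] field_simps)
  qed
qed

text \<open>The lower bound gives injectivity and, applied to preimages, bounds the inverse by
  \<open>1 / c\<close>.\<close>

lemma invertible_operatorI_surj:
  assumes A: "bounded_clinear A" and "c > 0" and c: "\<And>x. c * norm x \<le> norm (A x)" and "surj A"
  shows "invertible_operator A"
proof -
  have "inj A"
  proof (rule injI)
    fix x y assume "A x = A y"
    then have "c * norm (x - y) \<le> 0" using c[of "x - y"] bounded_clinear_diff[OF A, of x y] by simp
    then show "x = y" using \<open>c > 0\<close> by (simp add: mult_le_0_iff)
  qed
  then have inv: "inv A (A x) = x" "A (inv A y) = y" for x y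
    using \<open>surj A\<close> by (simp_all add: surj_f_inv_f)
  have "bounded_clinear (inv A)"
  proof (rule bounded_clinearI)
    show "inv A (x + y) = inv A x + inv A y" for x y
      using inv(1)[of "inv A x + inv A y"] by (simp add: bounded_clinear_add[OF A] inv(2))
    show "inv A (z *\<^sub>C x) = z *\<^sub>C inv A x" for z x
      using inv(1)[of "z *\<^sub>C inv A x"] by (simp add: bounded_clinear_scaleC[OF A] inv(2))
    show "norm (inv A x) \<le> (1 / c) * norm x" for x
      using c[of "inv A x"] \<open>c > 0\<close> by (simp add: inv field_simps)
  qed
  then show ?thesis
    unfolding invertible_operator_def
    by (intro exI[of _ "inv A"] bounded_inverseI[of A "inv A" "inv A"] A inv)
qed

text \<open>Solving \<open>x - B x = y\<close> means finding a fixed point of the contraction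
  \<open>x\<close> to \<open>y + B x\<close>; Banach's theorem here takes the place of the Neumann
  series.\<close>

lemma invertible_operator_id_minus:
  fixes B :: "'a::complex_hilbert \<Rightarrow> 'a"
  assumes B: "bounded_clinear B" and q: "0 \<le> q" "q < 1" "\<And>x. norm (B x) \<le> q * norm x"
  shows "invertible_operator (\<lambda>x. x - B x)"
proof (rule invertible_operatorI_surj)
  show "bounded_clinear (\<lambda>x. x - B x)"
    by (intro bounded_clinear_minus bounded_clinear_id B)
  show "1 - q > 0" using q by simp
  show "(1 - q) * norm x \<le> norm (x - B x)" for x
    using norm_triangle_ineq2[of x "B x"] q(3)[of x] by (simp add: algebra_simps)
  have "\<exists>x. x - B x = y" for y
  proof -
    have "\<exists>!x. y + B x = x"
      using q by (intro banach_fix_type[of q])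
        (simp_all add: dist_norm flip: bounded_clinear_diff[OF B])
    then obtain x where "y + B x = x" by blast
    then show ?thesis by (metis add_diff_cancel_right')
  qed
  then show "surj (\<lambda>x. x - B x)" by (metis surjI)
qed

text \<open>The sign convention is the inverse of \<open>T - z\<close>, not of \<open>z - T\<close>,
  which is why Riesz projections appear below with a minus sign. On the spectrum the value is
  arbitrary.\<close>

definition resolvent :: "('a::complex_inner \<Rightarrow> 'a) \<Rightarrow> complex \<Rightarrow> 'a \<Rightarrow> 'a" where
  "resolvent T z = (SOME B. bounded_inverse (\<lambda>x. T x - z *\<^sub>C x) B)"

lemma bounded_inverse_resolvent:
  "z \<notin> spectrum T \<Longrightarrow> bounded_inverse (\<lambda>x. T x - z *\<^sub>C x) (resolvent T z)"
  unfolding resolvent_def spectrum_def invertible_operator_def by (metis (mono_tags, lifting) mem_Collect_eq someI_ex)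

lemmas resolvent_simps =
  bounded_inverseD(3)[OF bounded_inverse_resolvent] bounded_inverseD(4)[OF bounded_inverse_resolvent]

lemma apply_resolvent: "z \<notin> spectrum T \<Longrightarrow> T (resolvent T z x) = x + z *\<^sub>C resolvent T z x"
  using resolvent_simps(2)[of z T x] by (simp add: algebra_simps)

lemma resolvent_apply:
  assumes "bounded_clinear T" "z \<notin> spectrum T"
  shows "resolvent T z (T x) = T (resolvent T z x)"
proof -
  have "resolvent T z (T x - z *\<^sub>C x) = T (resolvent T z x) - z *\<^sub>C resolvent T z x"
    using assms by (simp add: resolvent_simps)
  then show ?thesis
    using bounded_inverseD(2)[OF bounded_inverse_resolvent[OF assms(2)]]
    by (simp add: bounded_clinear_diff bounded_clinear_scaleC)
qed

text \<open>The first resolvent identity: insert \<open>T - z\<close> in front of the resolvent at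
  \<open>z\<close> and \<open>T - w\<close> behind the resolvent at \<open>w\<close>; the terms with
  \<open>T\<close> cancel.\<close>

lemma resolvent_diff:
  assumes T: "bounded_clinear T" and "w \<notin> spectrum T" "z \<notin> spectrum T"
  shows "resolvent T w x - resolvent T z x = (w - z) *\<^sub>C resolvent T w (resolvent T z x)"
proof -
  let ?R = "resolvent T w"
  have R: "bounded_clinear ?R"
    by (rule bounded_inverseD(2)[OF bounded_inverse_resolvent[OF assms(2)]])
  have "?R x = ?R (T (resolvent T z x) - z *\<^sub>C resolvent T z x)"
    using assms by (simp add: resolvent_simps)
  moreover have "resolvent T z x = ?R (T (resolvent T z x) - w *\<^sub>C resolvent T z x)"
    using assms by (simp add: resolvent_simps)
  ultimately show ?thesis
    by (simp add: bounded_clinear_diff[OF R] bounded_clinear_scaleC[OF R] scaleC.diff_left algebra_simps)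
qed

text \<open>\<open>T - w\<close> factors as \<open>I - (w - z) R\<close> after \<open>T - z\<close>,
  with \<open>R\<close> the resolvent at \<open>z\<close>; the first factor is a small perturbation
  of the identity once \<open>w\<close> is within \<open>1 / K\<close> of \<open>z\<close>.\<close>

lemma open_resolvent_set:
  fixes T :: "'a::complex_hilbert \<Rightarrow> 'a"
  assumes T: "bounded_clinear T"
  shows "open (- spectrum T)"
  unfolding open_dist
proof
  fix z assume "z \<in> - spectrum T"
  then have z: "z \<notin> spectrum T" by simp
  note R = bounded_inverse_resolvent[OF z]
  obtain K where K: "K > 0" "\<And>x. norm (resolvent T z x) \<le> K * norm x"
    using bounded_clinear_bound[OF bounded_inverseD(2)[OF R]] by blast
  have "w \<notin> spectrum T" if w: "dist w z < 1 / K" for w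
  proof -
    have "invertible_operator (\<lambda>x. x - (w - z) *\<^sub>C resolvent T z x)"
    proof (rule invertible_operator_id_minus)
      show "bounded_clinear (\<lambda>x. (w - z) *\<^sub>C resolvent T z x)"
        by (intro bounded_clinear_scale bounded_inverseD(2)[OF R])
      show "norm ((w - z) *\<^sub>C resolvent T z x) \<le> (cmod (w - z) * K) * norm x" for x
        using mult_left_mono[OF K(2)[of x], of "cmod (w - z)"] by (simp add: norm_scaleC mult.assoc)
      show "cmod (w - z) * K < 1" using w K by (simp add: dist_norm field_simps)
    qed (use K in simp)
    then have "invertible_operator (\<lambda>x. (T x - z *\<^sub>C x)
        - (w - z) *\<^sub>C resolvent T z (T x - z *\<^sub>C x))"
      by (rule invertible_operator_compose) (use z in \<open>simp add: spectrum_def\<close>)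
    then show ?thesis using z by (simp add: spectrum_def resolvent_simps scaleC.diff_left)
  qed
  then show "\<exists>e>0. \<forall>y. dist y z < e \<longrightarrow> y \<in> - spectrum T"
    using K(1) by (intro exI[of _ "1 / K"]) auto
qed

text \<open>\<open>T - z\<close> is \<open>- z\<close> times \<open>I - T / z\<close>, and
  \<open>T / z\<close> is a strict contraction.\<close>

lemma spectrum_bounded:
  fixes T :: "'a::complex_hilbert \<Rightarrow> 'a"
  assumes T: "bounded_clinear T" and K: "\<And>x. norm (T x) \<le> K * norm x" and z: "K < cmod z" "0 \<le> K"
  shows "z \<notin> spectrum T"
proof -
  have z0: "z \<noteq> 0" using z by auto
  have "invertible_operator (\<lambda>x. x - (1 / z) *\<^sub>C T x)"
  proof (rule invertible_operator_id_minus)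
    show "norm ((1 / z) *\<^sub>C T x) \<le> (K / cmod z) * norm x" for x
      using K[of x] by (simp add: norm_scaleC norm_divide divide_right_mono)
  qed (use z in \<open>auto intro!: bounded_clinear_scale T simp: divide_less_eq\<close>)
  from invertible_operator_compose[OF invertible_operator_scaleC this, of "- z"] z0
  show ?thesis by (simp add: spectrum_def scaleC.diff_right scaleC_scaleC scaleC_one)
qed

text \<open>A lower bound \<open>c\<close> for \<open>T - z\<close> survives as \<open>c / 2\<close>
  for all \<open>w\<close> within \<open>c / 2\<close> of \<open>z\<close>; compactness leaves
  finitely many such constants.\<close>

lemma resolvent_uniform_bound:
  fixes T :: "'a::complex_hilbert \<Rightarrow> 'a"
  assumes T: "bounded_clinear T" and K: "compact K" "K \<inter> spectrum T = {}"
  obtains M where "M > 0" "\<And>z x. z \<in> K \<Longrightarrow> norm (resolvent T z x) \<le> M * norm x"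
proof -
  have "\<exists>c>0. \<forall>w\<in>ball z c. \<forall>x. c * norm x \<le> norm (T x - w *\<^sub>C x)" if "z \<in> K" for z
  proof -
    have "invertible_operator (\<lambda>x. T x - z *\<^sub>C x)" using that K by (auto simp: spectrum_def)
    then obtain c where c: "c > 0" "\<And>x. c * norm x \<le> norm (T x - z *\<^sub>C x)"
      using invertible_operator_bounded_below by blast
    have "c / 2 * norm x \<le> norm (T x - w *\<^sub>C x)" if "w \<in> ball z (c / 2)" for w x
    proof -
      have "norm (T x - z *\<^sub>C x) \<le> norm (T x - w *\<^sub>C x) + norm ((w - z) *\<^sub>C x)"
        using norm_triangle_ineq[of "T x - w *\<^sub>C x" "(w - z) *\<^sub>C x"] by (simp add: scaleC.diff_left)
      moreover have "norm ((w - z) *\<^sub>C x) \<le> c / 2 * norm x"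
        using that unfolding norm_scaleC by (intro mult_right_mono) (auto simp: dist_norm norm_minus_commute)
      ultimately show ?thesis using c(2)[of x] by simp
    qed
    then show ?thesis using c(1) by (intro exI[of _ "c / 2"]) auto
  qed
  then obtain c where c: "\<And>z. z \<in> K \<Longrightarrow> c z > 0"
    "\<And>z w x. z \<in> K \<Longrightarrow> w \<in> ball z (c z) \<Longrightarrow> c z * norm x \<le> norm (T x - w *\<^sub>C x)"
    by metis
  obtain F where F: "F \<subseteq> K" "finite F" "K \<subseteq> (\<Union>z\<in>F. ball z (c z))"
    by (rule compactE_image[OF K(1), of K "\<lambda>z. ball z (c z)"]) (use c(1) in force)+
  \<comment> \<open>The extra 1 keeps the minimum meaningful when \<open>F\<close> is empty.\<close>
  let ?d = "Min (insert 1 (c ` F))"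
  have d: "?d > 0" using F c(1) by auto
  show ?thesis
  proof (rule that)
    show "1 / ?d > 0" using d by simp
    fix w x assume w: "w \<in> K"
    then obtain z where z: "z \<in> F" "w \<in> ball z (c z)" using F by blast
    let ?y = "resolvent T w x"
    have "?d * norm ?y \<le> c z * norm ?y" using z F by (intro mult_right_mono) auto
    also have "\<dots> \<le> norm (T ?y - w *\<^sub>C ?y)" using c(2) z F by blast
    also have "T ?y - w *\<^sub>C ?y = x" using w K by (intro resolvent_simps) auto
    finally show "norm ?y \<le> 1 / ?d * norm x" using d by (simp add: field_simps)
  qed
qed

text \<open>The resolvent identity and a uniform bound \<open>M\<close> make the map Lipschitz with
  constant \<open>M * (M * norm x)\<close>.\<close>

lemma continuous_on_resolvent:
  fixes T :: "'a::complex_hilbert \<Rightarrow> 'a"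
  assumes T: "bounded_clinear T" and K: "compact K" "K \<inter> spectrum T = {}"
  shows "continuous_on K (\<lambda>z. resolvent T z x)"
proof -
  obtain M where M: "M > 0" "\<And>z x. z \<in> K \<Longrightarrow> norm (resolvent T z x) \<le> M * norm x"
    using resolvent_uniform_bound[OF assms] by blast
  have "dist (resolvent T w x) (resolvent T z x) \<le> (M * (M * norm x)) * dist w z"
    if "w \<in> K" "z \<in> K" for w z
  proof -
    have "dist (resolvent T w x) (resolvent T z x)
        = dist w z * norm (resolvent T w (resolvent T z x))"
      using that K by (subst dist_norm, subst resolvent_diff[OF T])
        (auto simp: dist_norm norm_scaleC)
    moreover have "norm (resolvent T w (resolvent T z x)) \<le> M * (M * norm x)"
      by (rule order.trans[OF M(2)[OF that(1)] mult_left_mono[OF M(2)[OF that(2)]]]) (use M in simp)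
    ultimately show ?thesis by (simp only: mult.commute[of _ "dist w z"] mult_left_mono zero_le_dist)
  qed
  then have "(M * (M * norm x))-lipschitz_on K (\<lambda>z. resolvent T z x)"
    using M(1) by (intro lipschitz_onI) auto
  then show ?thesis by (rule lipschitz_on_continuous_on)
qed

section \<open>The shape and nonemptiness of spectra\<close>

lemma norm_cis_diff_one_le: "cmod (cis t - 1) \<le> \<bar>t\<bar>"
  using dist_exp_i_1[of t] abs_sin_x_le_abs_x[of "t / 2"] by (simp add: cis_conv_exp)

text \<open>Iterated roots of one and the same number are dense in the circle.\<close>

lemma power_invariant_imp_rotation_invariant:
  fixes S :: "complex set"
  assumes "2 \<le> n" "closed S" and inv: "\<And>z. z \<in> S \<longleftrightarrow> z ^ n \<in> S"
    and z: "z \<in> S" and wz: "cmod w = cmod z"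
  shows "w \<in> S"
proof (rule ccontr)
  assume "w \<notin> S"
  then obtain e where e: "e > 0" "ball w e \<subseteq> - S"
    using \<open>closed S\<close> open_contains_ball[of "- S"] by (auto simp: closed_def)
  have "w \<noteq> 0" using \<open>w \<notin> S\<close> wz z by auto
  have iter: "u \<in> S \<longleftrightarrow> u ^ (n ^ k) \<in> S" for u k
    by (induction k arbitrary: u) (use inv in \<open>auto simp: power_mult mult.commute\<close>)
  define \<phi> where "\<phi> = Arg (z / w)"
  have z_eq: "z = w * cis \<phi>"
    using cis_Arg_unique \<open>w \<noteq> 0\<close> wz Arg_eq[of "z / w"]
    by (cases "z = 0") (auto simp: \<phi>_def norm_divide cis_conv_exp)
  \<comment> \<open>The spacing of the \<open>N\<close>-th roots along the circle through
    \<open>w\<close> is at most \<open>2 * pi * cmod w / N\<close>; \<open>k\<close> makes it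
    smaller than \<open>e\<close>.\<close>
  obtain k where k: "2 * pi * cmod w / e < real n ^ k"
    using real_arch_pow[of "real n"] \<open>2 \<le> n\<close> by auto
  define N where "N = n ^ k"
  have N: "real N > 0" "2 * pi * cmod w / real N < e"
    using k e(1) \<open>2 \<le> n\<close> by (auto simp: N_def field_simps)
  \<comment> \<open>Rotating by multiples of \<open>2 * pi / N\<close> does not change
    \<open>N\<close>-th powers. Removing \<open>j\<close> of them from the angle between
    \<open>w\<close> and \<open>z\<close> leaves a remainder \<theta> of at most one step.\<close>
  define j where "j = \<lfloor>\<phi> * real N / (2 * pi)\<rfloor>"
  define \<theta> where "\<theta> = \<phi> - 2 * pi * of_int j / real N"
  have "0 \<le> \<phi> * real N / (2 * pi) - of_int j" "\<phi> * real N / (2 * pi) - of_int j \<le> 1"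
    unfolding j_def by linarith+
  moreover have "\<theta> = (\<phi> * real N / (2 * pi) - of_int j) * (2 * pi / real N)"
    using N(1) by (simp add: \<theta>_def field_simps)
  ultimately have \<theta>: "0 \<le> \<theta>" "\<theta> \<le> 2 * pi / real N"
    using N(1) mult_right_mono[of _ 1 "2 * pi / real N"] by simp_all
  define u where "u = w * cis \<theta>"
  have "real N * \<phi> = real N * \<theta> + 2 * pi * of_int j"
    using N(1) by (simp add: \<theta>_def field_simps)
  then have "cis (real N * \<phi>) = cis (real N * \<theta>)"
    by (simp add: cis_mult[symmetric] cis_multiple_2pi)
  then have "u ^ N = z ^ N"
    by (simp add: u_def z_eq power_mult_distrib Complex.DeMoivre)
  moreover have "z ^ N \<in> S" using iter z by (simp add: N_def)
  ultimately have "u \<in> S" using iter[of u k] by (simp add: N_def)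
  moreover have "dist w u < e"
  proof -
    have "dist w u = cmod w * cmod (cis \<theta> - 1)"
      by (simp add: u_def dist_norm norm_minus_commute algebra_simps flip: norm_mult)
    also have "\<dots> \<le> cmod w * (2 * pi / real N)"
      using norm_cis_diff_one_le[of \<theta>] \<theta> by (intro mult_left_mono) auto
    finally show ?thesis using N(2) by (simp add: mult_ac)
  qed
  ultimately show False using e(2) by (auto simp: subset_iff)
qed

section \<open>Nonemptiness of the spectrum\<close>

lemma bounded_linear_cinner_left: "bounded_linear (\<lambda>x. cinner x y)"
proof (rule bounded_linear_intro[where K = "2 * norm y"])
  show "cinner (r *\<^sub>R x) y = r *\<^sub>R cinner x y" for r x
    by (simp add: scaleR_scaleC cinner_scaleC_left scaleR_conv_of_real)
  show "norm (cinner x y) \<le> norm x * (2 * norm y)" for x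
  proof -
    \<comment> \<open>Multiplication by i turns the imaginary part into a real inner product, so the
      real Cauchy-Schwarz inequality bounds both parts. The resulting factor 2 is crude but
      harmless.\<close>
    have "Im (cinner x y) = - inner (\<i> *\<^sub>C x) y"
      by (simp add: inner_eq_Re_cinner cinner_scaleC_left)
    then have "\<bar>Im (cinner x y)\<bar> \<le> norm x * norm y"
      using Cauchy_Schwarz_ineq2[of "\<i> *\<^sub>C x" y] by (simp add: norm_scaleC)
    moreover have "\<bar>Re (cinner x y)\<bar> \<le> norm x * norm y"
      using Cauchy_Schwarz_ineq2[of x y] by (simp add: inner_eq_Re_cinner)
    ultimately show ?thesis using cmod_le[of "cinner x y"] by simp
  qed
qed (rule cinner_add_left)

text \<open>Liouville's theorem: with empty spectrum a scalar matrix element of the resolvent would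
  be entire and vanish at infinity.\<close>

lemma spectrum_nonempty:
  fixes T :: "'a::complex_hilbert \<Rightarrow> 'a" and x :: 'a
  assumes T: "bounded_clinear T" and "x \<noteq> 0"
  shows "spectrum T \<noteq> {}"
proof
  assume empty: "spectrum T = {}"
  \<comment> \<open>This choice makes \<open>f 0\<close> the squared norm of \<open>y\<close>, so
    that \<open>f 0 = 0\<close> forces \<open>y = 0\<close> and hence
    \<open>x = T y = 0\<close>.\<close>
  define y where "y = resolvent T 0 x"
  define f where "f z = cinner (resolvent T z x) y" for z
  \<comment> \<open>By the resolvent identity the difference quotient is itself a matrix element, so
    differentiability reduces to continuity of the resolvent.\<close>
  have f_diff: "f w - f z = (w - z) * cinner (resolvent T w (resolvent T z x)) y" for w z
    by (simp add: f_def resolvent_diff[OF T] empty cinner_scaleC_left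
        flip: linear_diff[OF bounded_linear.linear, OF bounded_linear_cinner_left])
  have "(f has_field_derivative cinner (resolvent T z (resolvent T z x)) y) (at z)" for z
  proof -
    have "continuous_on (cball z 1) (\<lambda>w. resolvent T w (resolvent T z x))"
      by (rule continuous_on_resolvent[OF T]) (simp_all add: empty)
    then have "isCont (\<lambda>w. resolvent T w (resolvent T z x)) z"
      by (rule continuous_on_interior) simp
    then have "isCont (\<lambda>w. cinner (resolvent T w (resolvent T z x)) y) z"
      by (rule bounded_linear.continuous[OF bounded_linear_cinner_left])
    then have "((\<lambda>w. cinner (resolvent T w (resolvent T z x)) y) \<longlongrightarrow>
        cinner (resolvent T z (resolvent T z x)) y) (at z)"
      by (simp add: isCont_def)
    then show ?thesis
      unfolding has_field_derivative_iff
      by (rule Lim_transform_eventually) (simp add: f_diff eventually_at_filter)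
  qed
  then have "f holomorphic_on UNIV"
    by (auto simp: holomorphic_on_def field_differentiable_def intro: has_field_derivative_at_within)
  moreover have "(f \<longlongrightarrow> 0) at_infinity"
  proof -
    obtain K where K: "K > 0" "\<And>v. norm (T v) \<le> K * norm v"
      using bounded_clinear_bound[OF T] by blast
    obtain C where C: "\<And>v. norm (cinner v y) \<le> norm v * C"
      using bounded_linear.nonneg_bounded[OF bounded_linear_cinner_left[of y]] by blast
    have bound: "norm (f z) \<le> (norm x * \<bar>C\<bar>) / (cmod z - K)" if z: "K < cmod z" for z
    proof -
      let ?v = "resolvent T z x"
      have "cmod z * norm ?v = norm (T ?v - x)"
        using apply_resolvent[of z T x] empty by (simp add: norm_scaleC)
      also have "\<dots> \<le> K * norm ?v + norm x"
        using norm_triangle_ineq4[of "T ?v" x] K(2)[of ?v] by linarith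
      finally have "norm ?v \<le> norm x / (cmod z - K)"
        using z by (simp add: field_simps)
      then have "norm ?v * \<bar>C\<bar> \<le> norm x / (cmod z - K) * \<bar>C\<bar>" by (rule mult_right_mono) simp
      moreover have "norm (f z) \<le> norm ?v * \<bar>C\<bar>"
        unfolding f_def by (rule order.trans[OF C mult_left_mono]) auto
      ultimately show ?thesis by simp
    qed
    have "filterlim (\<lambda>z :: complex. - K + norm z) at_top at_infinity"
      by (rule filterlim_tendsto_add_at_top[OF tendsto_const filterlim_norm_at_top])
    then have "((\<lambda>z :: complex. (norm x * \<bar>C\<bar>) / (cmod z - K)) \<longlongrightarrow> 0) at_infinity"
      by (intro tendsto_divide_0[OF tendsto_const] filterlim_at_top_imp_at_infinity) simp
    then show ?thesis
    proof (rule Lim_null_comparison[rotated])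
      show "\<forall>\<^sub>F z in at_infinity. norm (f z) \<le> (norm x * \<bar>C\<bar>) / (cmod z - K)"
        unfolding eventually_at_infinity using bound by (intro exI[of _ "K + 1"]) auto
    qed
  qed
  ultimately have "f 0 = 0" by (rule Liouville_weak_0)
  then have "y = 0" by (simp add: f_def flip: y_def, simp add: cinner_self)
  then have "x = 0"
    using apply_resolvent[of 0 T x] empty bounded_clinear_0[OF T] by (simp add: y_def)
  then show False using \<open>x \<noteq> 0\<close> by simp
qed

section \<open>Riesz projections and decaying orbits\<close>

text \<open>\<open>resolvent_moment T s k\<close> is the integral of \<open>z\<^sup>k (T - z)\<inverse>\<close> over the circle of radius \<open>s\<close>
  with respect to normalized arc length; for \<open>k = 1\<close> it is minus the Riesz projection.\<close>

definition circle_power :: "real \<Rightarrow> int \<Rightarrow> real \<Rightarrow> complex" where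
  "circle_power s k t = complex_of_real (s powi k) * cis (2 * pi * of_int k * t)"

definition resolvent_moment :: "('a::complex_hilbert \<Rightarrow> 'a) \<Rightarrow> real \<Rightarrow> int \<Rightarrow> 'a \<Rightarrow> 'a" where
  "resolvent_moment T s k x =
     integral {0..1} (\<lambda>t. circle_power s k t *\<^sub>C resolvent T (circle_power s 1 t) x)"

lemma norm_circle_power: "s > 0 \<Longrightarrow> cmod (circle_power s k t) = s powi k"
  by (simp add: circle_power_def norm_mult norm_power_int)

lemma circle_power_add_1:
  "s > 0 \<Longrightarrow> circle_power s (k + 1) t = circle_power s k t * circle_power s 1 t"
  by (simp add: circle_power_def power_int_add cis_mult[symmetric] ring_distribs)

lemma continuous_on_circle_power: "continuous_on A (circle_power s k)"
  unfolding circle_power_def by (intro continuous_intros)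

text \<open>Orthogonality of the exponentials: for nonzero \<open>k\<close> the antiderivative is
  1-periodic.\<close>

lemma has_integral_circle_power:
  "(circle_power s k has_integral (if k = 0 then 1 else 0)) {0..1}"
proof (cases "k = 0")
  case True
  then have "circle_power s k = (\<lambda>_. 1)" by (simp add: circle_power_def fun_eq_iff)
  then show ?thesis using True has_integral_const_real[of "1 :: complex" 0 1] by simp
next
  case False
  define c where "c = 2 * pi * of_int k * \<i>"
  have "c \<noteq> 0" using False by (simp add: c_def)
  let ?F = "\<lambda>t. complex_of_real (s powi k) * (exp (c * of_real t) / c)"
  have "(circle_power s k has_integral (?F 1 - ?F 0)) {0..1}"
  proof (rule fundamental_theorem_of_calculus)
    fix t :: real assume "t \<in> {0..1}"
    have "((\<lambda>t. ?F t) has_vector_derivative complex_of_real (s powi k) * exp (c * of_real t)) (at t within {0..1})"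
      using \<open>c \<noteq> 0\<close>
      by (auto intro!: derivative_eq_intros has_vector_derivative_real_field simp: o_def)
    moreover have "exp (c * of_real t) = cis (2 * pi * of_int k * t)"
      by (simp add: c_def cis_conv_exp algebra_simps)
    ultimately show "(?F has_vector_derivative circle_power s k t) (at t within {0..1})"
      by (simp add: circle_power_def)
  qed simp
  moreover have "exp c = 1"
    using cis_multiple_2pi[of "of_int k"] by (simp add: c_def cis_conv_exp algebra_simps)
  ultimately show ?thesis using False by simp
qed

section \<open>Algebra of the resolvent moments on a circle that avoids the spectrum\<close>

context
  fixes T :: "'a::complex_hilbert \<Rightarrow> 'a" and s :: real
  assumes T: "bounded_clinear T" and s: "s > 0" and disj: "sphere 0 s \<inter> spectrum T = {}"
begin

lemma circle_power_1_in_sphere: "circle_power s 1 t \<in> sphere 0 s"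
  using norm_circle_power[OF s, of 1 t] by simp

lemma circle_power_1_notin_spectrum: "circle_power s 1 t \<notin> spectrum T"
  using circle_power_1_in_sphere disj by blast

lemma continuous_on_resolvent_moment:
  "continuous_on {0..1} (\<lambda>t. circle_power s k t *\<^sub>C resolvent T (circle_power s 1 t) x)"
proof -
  have "continuous_on (sphere 0 s) (\<lambda>z. resolvent T z x)"
    by (rule continuous_on_resolvent[OF T]) (use disj in auto)
  then have "continuous_on {0..1} (\<lambda>t. resolvent T (circle_power s 1 t) x)"
    by (rule continuous_on_compose2[OF _ continuous_on_circle_power])
      (use circle_power_1_in_sphere in blast)
  then show ?thesis by (intro scaleC.continuous_on continuous_on_circle_power)
qed

lemma resolvent_moment_integrable:
  "(\<lambda>t. circle_power s k t *\<^sub>C resolvent T (circle_power s 1 t) x) integrable_on {0..1}"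
  using continuous_on_resolvent_moment by (rule integrable_continuous_real)

text \<open>Under the integral, \<open>T\<close> times the resolvent is the identity plus
  \<open>z\<close> times the resolvent. The second term raises the moment by one; the first
  integrates a power of \<open>z\<close>, which survives only for exponent 0.\<close>

lemma apply_resolvent_moment:
  "T (resolvent_moment T s k x) = resolvent_moment T s (k + 1) x + (if k = 0 then x else 0)"
proof -
  have "T (resolvent_moment T s k x) = integral {0..1} (\<lambda>t. circle_power s k t *\<^sub>C x
      + circle_power s (k + 1) t *\<^sub>C resolvent T (circle_power s 1 t) x)"
    unfolding resolvent_moment_def
    by (subst integral_linear[OF resolvent_moment_integrable
          bounded_clinear_imp_bounded_linear[OF T], symmetric])
      (simp add: o_def bounded_clinear_scaleC[OF T] apply_resolvent[OF circle_power_1_notin_spectrum]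
        scaleC_add_right scaleC_scaleC circle_power_add_1[OF s])
  also have "\<dots> = integral {0..1} (\<lambda>t. circle_power s k t *\<^sub>C x) + resolvent_moment T s (k + 1) x"
    unfolding resolvent_moment_def
    by (intro integral_add integrable_continuous_real continuous_on_resolvent_moment
        scaleC.continuous_on continuous_on_circle_power continuous_intros)
  also have "integral {0..1} (\<lambda>t. circle_power s k t *\<^sub>C x) = (if k = 0 then 1 else 0) *\<^sub>C x"
    using has_integral_linear[OF has_integral_circle_power scaleC.bounded_linear_left[of x], of s k]
    by (simp add: o_def integral_unique)
  also have "\<dots> = (if k = 0 then x else 0)"
    by (simp add: scaleC_one)
  finally show ?thesis by (simp add: add.commute)
qed

lemma resolvent_moment_apply:
  "resolvent_moment T s k (T x) = T (resolvent_moment T s k x)"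
  unfolding resolvent_moment_def
  by (subst integral_linear[OF resolvent_moment_integrable
        bounded_clinear_imp_bounded_linear[OF T], symmetric])
    (simp add: o_def bounded_clinear_scaleC[OF T] resolvent_apply[OF T circle_power_1_notin_spectrum])

lemma resolvent_moment_apply_funpow:
  "resolvent_moment T s k ((T ^^ m) x) = (T ^^ m) (resolvent_moment T s k x)"
  by (induction m) (simp_all add: resolvent_moment_apply)

text \<open>A single \<open>M\<close>, the bound of the resolvent on the circle, serves all moments;
  the index enters only through the modulus of the weight.\<close>

lemma norm_resolvent_moment_le:
  obtains M where "M > 0" "\<And>k x. norm (resolvent_moment T s k x) \<le> s powi k * M * norm x"
proof -
  obtain M where M: "M > 0" "\<And>z x. z \<in> sphere 0 s \<Longrightarrow> norm (resolvent T z x) \<le> M * norm x"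
    using resolvent_uniform_bound[OF T compact_sphere disj] by blast
  have "norm (resolvent_moment T s k x) \<le> s powi k * M * norm x * (1 - 0)" for k x
    unfolding resolvent_moment_def
  proof (rule integral_bound[OF _ continuous_on_resolvent_moment])
    show "norm (circle_power s k t *\<^sub>C resolvent T (circle_power s 1 t) x) \<le> s powi k * M * norm x" for t
      using mult_left_mono[OF M(2)[OF circle_power_1_in_sphere[of t], of x], of "s powi k"] s
      by (simp add: norm_scaleC norm_circle_power mult.assoc)
  qed simp
  then show ?thesis using that M(1) by simp
qed

lemma bounded_clinear_resolvent_moment: "bounded_clinear (resolvent_moment T s k)"
proof -
  note R = bounded_inverseD(2)[OF bounded_inverse_resolvent[OF circle_power_1_notin_spectrum]]
  obtain M where M: "\<And>x. norm (resolvent_moment T s k x) \<le> s powi k * M * norm x"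
    using norm_resolvent_moment_le by metis
  show ?thesis
  proof (rule bounded_clinearI[OF _ _ M])
    show "resolvent_moment T s k (x + y) = resolvent_moment T s k x + resolvent_moment T s k y" for x y
      unfolding resolvent_moment_def
      by (simp add: bounded_clinear_add[OF R] scaleC_add_right
          integral_add[OF resolvent_moment_integrable resolvent_moment_integrable])
    show "resolvent_moment T s k (c *\<^sub>C x) = c *\<^sub>C resolvent_moment T s k x" for c x
      unfolding resolvent_moment_def
      by (subst integral_linear[OF resolvent_moment_integrable scaleC.bounded_linear_right, symmetric])
        (simp add: o_def bounded_clinear_scaleC[OF R] scaleC_scaleC mult.commute)
  qed
qed

text \<open>Starting at index 1, \<open>T\<close> is never applied to moment 0, so the correction
  term does not occur.\<close>

lemma funpow_resolvent_moment_1: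
  "(T ^^ m) (resolvent_moment T s 1 x) = resolvent_moment T s (int m + 1) x"
  by (induction m) (simp_all add: apply_resolvent_moment add_ac)

text \<open>The \<open>m\<close> applications of \<open>T\<close> act on the indices from
  \<open>- m\<close> to \<open>- 1\<close>, just short of the one with a correction term.\<close>

lemma funpow_resolvent_moment_neg:
  "(T ^^ m) (resolvent_moment T s (- int m) x) = resolvent_moment T s 0 x"
proof (induction m)
  case (Suc m)
  have "(T ^^ Suc m) (resolvent_moment T s (- int (Suc m)) x)
      = (T ^^ m) (T (resolvent_moment T s (- int m - 1) x))"
    unfolding funpow_Suc_right comp_apply by (simp only: of_nat_Suc minus_add_distrib diff_conv_add_uminus add.commute)
  also have "T (resolvent_moment T s (- int m - 1) x) = resolvent_moment T s (- int m) x"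
    by (simp add: apply_resolvent_moment)
  finally show ?case using Suc by simp
qed simp

text \<open>\<open>T\<close> applied to moment 0 is moment 1 plus the identity. If moment 1
  vanishes, moment 0 is a right inverse, and it commutes with \<open>T\<close>.\<close>

lemma invertible_if_resolvent_moment_1_zero:
  assumes "\<And>x. resolvent_moment T s 1 x = 0"
  shows "invertible_operator T"
  unfolding invertible_operator_def
  using bounded_inverseI[OF T bounded_clinear_resolvent_moment[of 0], of "resolvent_moment T s 0"] assms
  by (auto simp: resolvent_moment_apply apply_resolvent_moment)

end

text \<open>The constant \<open>K\<close> may depend on the vector;
  \<open>norm_funpow_growth_space_le\<close> trades it for a uniform one at any larger rate
  \<open>s\<close> whose circle avoids the spectrum.\<close>

definition growth_space :: "('a::real_normed_vector \<Rightarrow> 'a) \<Rightarrow> real \<Rightarrow> 'a set" where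
  "growth_space T r = {x. \<exists>K. \<forall>m. norm ((T ^^ m) x) \<le> K * r ^ m}"

text \<open>On a vector in the range of the Riesz projection, \<open>T ^^ m\<close> yields moment
  \<open>m + 1\<close>, whose size is controlled by \<open>s ^ (m + 1)\<close>.\<close>

lemma growth_space_nontrivial:
  fixes T :: "'a::complex_hilbert \<Rightarrow> 'a"
  assumes T: "bounded_clinear T" "s > 0" "sphere 0 s \<inter> spectrum T = {}"
    and "\<not> invertible_operator T"
  shows "\<exists>x\<in>growth_space T s. x \<noteq> 0"
proof -
  obtain x where x: "resolvent_moment T s 1 x \<noteq> 0"
    using invertible_if_resolvent_moment_1_zero[OF T] assms(4) by blast
  obtain M where M: "\<And>k x. norm (resolvent_moment T s k x) \<le> s powi k * M * norm x"
    using norm_resolvent_moment_le[OF T] by metis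
  have "norm ((T ^^ m) (resolvent_moment T s 1 x)) \<le> (s * M * norm x) * s ^ m" for m
    using M[of "int m + 1" x] \<open>s > 0\<close>
    by (simp add: funpow_resolvent_moment_1[OF T] power_int_add mult_ac)
  then show ?thesis using x unfolding growth_space_def by blast
qed

text \<open>The integral over the circle inverts the Fourier expansion of the resolvent: on a vector \<open>x\<close>
  whose orbit decays faster than \<open>s\<^sup>m\<close>, the Riesz projection acts as the identity.\<close>

lemma norm_funpow_growth_space_le:
  fixes T :: "'a::complex_hilbert \<Rightarrow> 'a"
  assumes T: "bounded_clinear T" "s > 0" "sphere 0 s \<inter> spectrum T = {}"
  obtains M where "M > 0"
    "\<And>r x m. 0 \<le> r \<Longrightarrow> r < s \<Longrightarrow> x \<in> growth_space T r \<Longrightarrow> norm ((T ^^ m) x) \<le> M * s ^ m * norm x"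
proof -
  obtain M where M: "M > 0" "\<And>k x. norm (resolvent_moment T s k x) \<le> s powi k * M * norm x"
    using norm_resolvent_moment_le[OF T] by metis
  show ?thesis
  proof (rule that)
    show "s * M > 0" using M T(2) by simp
    fix r x m assume r: "0 \<le> r" "r < s" and "x \<in> growth_space T r"
    then obtain K where K: "\<And>m. norm ((T ^^ m) x) \<le> K * r ^ m"
      by (auto simp: growth_space_def)
    let ?P = "resolvent_moment T s 1"
    \<comment> \<open>As \<open>?P\<close> is minus the Riesz projection, this is the defect of
      \<open>x\<close> from being fixed by it. Moving \<open>j + 1\<close> powers of
      \<open>T\<close> onto \<open>x\<close> pits the decay \<open>r ^ (j + 1)\<close> against the
      growth \<open>s ^ -j\<close> of the moment.\<close>
    have "norm (?P x + x) \<le> (M * K * r) * (r / s) ^ j" for j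
    proof -
      have "?P x + x = T (resolvent_moment T s 0 x)" by (simp add: apply_resolvent_moment[OF T])
      also have "\<dots> = (T ^^ Suc j) (resolvent_moment T s (- int j) x)"
        by (simp add: funpow_resolvent_moment_neg[OF T])
      also have "\<dots> = resolvent_moment T s (- int j) ((T ^^ Suc j) x)"
        by (simp only: resolvent_moment_apply_funpow[OF T])
      also have "norm \<dots> \<le> s powi (- int j) * M * norm ((T ^^ Suc j) x)" by (rule M(2))
      also have "\<dots> \<le> s powi (- int j) * M * (K * r ^ Suc j)"
        using M(1) T(2) by (intro mult_left_mono K) simp
      also have "\<dots> = (M * K * r) * (r / s) ^ j"
        using T(2) by (simp add: power_int_minus field_simps)
      finally show ?thesis .
    qed
    moreover have "(\<lambda>j. (M * K * r) * (r / s) ^ j) \<longlonglongrightarrow> 0"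
      using r T(2) by (intro tendsto_mult_right_zero LIMSEQ_power_zero) simp
    ultimately have "norm (?P x + x) \<le> 0"
      by (intro LIMSEQ_le_const) auto
    then have "x = - ?P x" by (simp add: eq_neg_iff_add_eq_0 add.commute)
    then have "norm ((T ^^ m) x) = norm ((T ^^ m) (?P x))"
      using bounded_clinear_funpow[OF T(1), of m]
      by (metis bounded_linear.linear bounded_clinear_imp_bounded_linear linear_neg norm_minus_cancel)
    also have "\<dots> \<le> s powi (int m + 1) * M * norm x"
      using M(2) by (simp add: funpow_resolvent_moment_1[OF T])
    also have "\<dots> = (s * M) * s ^ m * norm x" using T(2) by (simp add: power_int_add mult_ac)
    finally show "norm ((T ^^ m) x) \<le> (s * M) * s ^ m * norm x" .
  qed
qed

section \<open>The operator \<open>J\<^sub>n(T)\<close>\<close>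

text \<open>Inverse of \<open>position\<close>, for naming coordinates by their number, starting at
  1; outside that range the value is arbitrary.\<close>

definition index_at :: "nat \<Rightarrow> 'n::{finite,linorder}" where
  "index_at k = inv_into UNIV position k"

lemma position_index_at:
  "k \<in> {1..CARD('n)} \<Longrightarrow> position (index_at k :: 'n::{finite,linorder}) = k"
  unfolding index_at_def
  by (rule f_inv_into_f) (use bij_betw_position[where 'n='n] in \<open>auto simp: bij_betw_def\<close>)

lemma index_at_position: "index_at (position i) = (i :: 'n::{finite,linorder})"
  unfolding index_at_def
  by (rule inv_into_f_f) (use bij_betw_position[where 'n='n] in \<open>auto simp: bij_betw_def\<close>)

lemma position_bounds: "position (i :: 'n::{finite,linorder}) \<in> {1..CARD('n)}"
  using bij_betw_position[where 'n='n] by (auto simp: bij_betw_def)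

lemma vec_eq_index_atI:
  fixes x y :: "'a ^ 'n::{finite,linorder}"
  assumes "\<And>k. 1 \<le> k \<Longrightarrow> k \<le> CARD('n) \<Longrightarrow> x $ index_at k = y $ index_at k"
  shows "x = y"
  unfolding vec_eq_iff
proof
  fix i show "x $ i = y $ i"
    using assms[of "position i"] position_bounds[of i] by (simp add: index_at_position)
qed

lemma index_at_eq_iff:
  assumes "k \<in> {1..CARD('n)}" "l \<in> {1..CARD('n)}"
  shows "index_at k = (index_at l :: 'n::{finite,linorder}) \<longleftrightarrow> k = l"
  using assms position_index_at[where 'n='n] by metis

lemma J_operator_index_at:
  fixes x :: "'a::complex_inner ^ 'n::{finite,linorder}"
  shows "1 \<le> k \<Longrightarrow> k < CARD('n) \<Longrightarrow> J_operator T x $ index_at k = x $ index_at (Suc k)"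
    and "J_operator T x $ index_at CARD('n) = T (x $ index_at 1)"
  by (rule J_operator_nth; simp add: position_index_at Suc_leI)+

lemma norm_axis: "norm (axis k x) = norm (x :: 'a::real_inner)"
  by (simp add: norm_eq_sqrt_inner inner_axis)

lemma bounded_clinear_axis: "bounded_clinear (axis k :: 'a::complex_inner \<Rightarrow> 'a ^ 'n::finite)"
proof (rule bounded_clinearI[where K = 1])
  show "norm (axis k x :: 'a ^ 'n) \<le> 1 * norm x" for x
    by (simp add: norm_axis)
qed (simp_all add: axis_def vec_eq_iff scaleC_vec_def scaleC.zero_right)

text \<open>\<open>J_operator T\<close> shifts coordinates cyclically and applies \<open>T\<close>
  when wrapping around; within \<open>CARD('n)\<close> shifts this happens at most once.\<close>

lemma funpow_J_operator_index_at:
  fixes x :: "'a::complex_inner ^ 'n::{finite,linorder}"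
  assumes "m \<le> CARD('n)" "1 \<le> k" "k \<le> CARD('n)"
  shows "(J_operator T ^^ m) x $ index_at k =
    (if k + m \<le> CARD('n) then x $ index_at (k + m) else T (x $ index_at (k + m - CARD('n))))"
  using assms
proof (induction m arbitrary: k)
  case (Suc m)
  show ?case
  proof (cases "k = CARD('n)")
    \<comment> \<open>After this wrap to coordinate 1, the remaining \<open>m < CARD('n)\<close>
      shifts cannot wrap again.\<close>
    case True
    then show ?thesis using Suc by (simp add: J_operator_index_at)
  next
    case False
    then show ?thesis using Suc by (simp add: J_operator_index_at)
  qed
qed simp

lemma funpow_J_operator:
  fixes x :: "'a::complex_inner ^ 'n::{finite,linorder}"
  shows "(J_operator T ^^ CARD('n)) x = (\<chi> i. T (x $ i))"
  by (rule vec_eq_index_atI) (simp add: funpow_J_operator_index_at)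

text \<open>The factorization of \<open>A ^ k - z ^ k\<close> by \<open>A - z\<close> from either
  side; the cofactor is built by the recursion that sends \<open>p\<close> to
  \<open>A p + z ^ k\<close>.\<close>

lemma funpow_minus_scale_factor:
  assumes A: "bounded_clinear (A :: 'a::complex_inner \<Rightarrow> 'a)"
  obtains p where "bounded_clinear p"
    "\<And>x. A (p x) - z *\<^sub>C p x = (A ^^ k) x - (z ^ k) *\<^sub>C x"
    "\<And>x. p (A x - z *\<^sub>C x) = (A ^^ k) x - (z ^ k) *\<^sub>C x"
proof -
  have "\<exists>p. bounded_clinear p \<and> (\<forall>x. A (p x) - z *\<^sub>C p x = (A ^^ k) x - (z ^ k) *\<^sub>C x) \<and>
      (\<forall>x. p (A x - z *\<^sub>C x) = (A ^^ k) x - (z ^ k) *\<^sub>C x)"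
  proof (induction k)
    case 0
    have "bounded_clinear (\<lambda>_ :: 'a. 0 :: 'a)"
      by (rule bounded_clinearI[where K = 0]) (simp_all add: scaleC.zero_right)
    then show ?case
      by (intro exI[of _ "\<lambda>_. 0"])
        (simp add: scaleC_one scaleC.zero_right bounded_clinear_0[OF A])
  next
    case (Suc k)
    then obtain p where p: "bounded_clinear p"
      "\<And>x. A (p x) - z *\<^sub>C p x = (A ^^ k) x - (z ^ k) *\<^sub>C x"
      "\<And>x. p (A x - z *\<^sub>C x) = (A ^^ k) x - (z ^ k) *\<^sub>C x" by auto
    let ?p = "\<lambda>x. A (p x) + (z ^ k) *\<^sub>C x"
    have "A (?p x) - z *\<^sub>C ?p x = A (A (p x) - z *\<^sub>C p x) + (z ^ k) *\<^sub>C (A x - z *\<^sub>C x)" for x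
      by (simp add: bounded_clinear_add[OF A] bounded_clinear_diff[OF A] bounded_clinear_scaleC[OF A]
          scaleC.diff_right scaleC_add_right scaleC_scaleC mult.commute)
    then have 1: "A (?p x) - z *\<^sub>C ?p x = (A ^^ Suc k) x - (z ^ Suc k) *\<^sub>C x" for x
      by (simp add: p(2) bounded_clinear_diff[OF A] bounded_clinear_scaleC[OF A]
          scaleC.diff_right scaleC_scaleC mult.commute)
    have 2: "?p (A x - z *\<^sub>C x) = (A ^^ Suc k) x - (z ^ Suc k) *\<^sub>C x" for x
      by (simp add: p(3) bounded_clinear_diff[OF A] bounded_clinear_scaleC[OF A]
          scaleC.diff_right scaleC_scaleC mult.commute)
    have "bounded_clinear ?p"
      by (rule bounded_clinear_plus[OF bounded_clinear_compose[OF A p(1)]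
            bounded_clinear_scale[OF bounded_clinear_id]])
    then show ?case using 1 2 by blast
  qed
  then show ?thesis using that by blast
qed

text \<open>Forward, \<open>J - z\<close> divides \<open>J ^ n - z ^ n\<close>, a direct sum of
  copies of \<open>T - z ^ n\<close>. Backward, an inverse of \<open>T - z ^ n\<close> is a corner
  entry of the inverse of \<open>J - z\<close>.\<close>

lemma spectrum_J_operator:
  fixes T :: "'a::complex_inner \<Rightarrow> 'a"
  assumes T: "bounded_clinear T"
    and J: "bounded_clinear (J_operator T :: ('a, 'n) vec \<Rightarrow> 'a ^ 'n::{finite,linorder})"
  shows "z \<in> spectrum (J_operator T :: ('a, 'n) vec \<Rightarrow> ('a, 'n) vec) \<longleftrightarrow> z ^ CARD('n) \<in> spectrum T"
proof -
  let ?J = "J_operator T :: ('a, 'n) vec \<Rightarrow> ('a, 'n) vec" and ?n = "CARD('n)"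
  have "z \<notin> spectrum ?J" if z: "z ^ ?n \<notin> spectrum T"
  proof -
    obtain G where G: "bounded_inverse (\<lambda>x. T x - (z ^ ?n) *\<^sub>C x) G"
      using z by (auto simp: spectrum_def invertible_operator_def)
    define H :: "('a, 'n) vec \<Rightarrow> ('a, 'n) vec" where "H x = (\<chi> i. G (x $ i))" for x
    have H: "bounded_clinear H"
      using bounded_clinear_compose[OF bounded_inverseD(2)[OF G] bounded_clinear_nth]
      by (intro bounded_clinear_vecI) (simp add: H_def)
    obtain p where p: "bounded_clinear p"
      "\<And>x. ?J (p x) - z *\<^sub>C p x = (?J ^^ ?n) x - (z ^ ?n) *\<^sub>C x"
      "\<And>x. p (?J x - z *\<^sub>C x) = (?J ^^ ?n) x - (z ^ ?n) *\<^sub>C x"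
      using funpow_minus_scale_factor[OF J] by blast
    have HJ: "H ((?J ^^ ?n) x - (z ^ ?n) *\<^sub>C x) = x" "(?J ^^ ?n) (H x) - (z ^ ?n) *\<^sub>C H x = x" for x
      by (simp_all add: funpow_J_operator H_def vec_eq_iff scaleC_vec_def bounded_inverseD(3,4)[OF G])
    \<comment> \<open>\<open>H\<close> inverts the product of \<open>J - z\<close> and
      \<open>p\<close>, so \<open>p\<close> after \<open>H\<close> is a right inverse and
      \<open>H\<close> after \<open>p\<close> a left one.\<close>
    have "bounded_inverse (\<lambda>x. ?J x - z *\<^sub>C x) (\<lambda>x. p (H x))"
      by (rule bounded_inverseI[OF bounded_clinear_sub_scale[OF J] bounded_clinear_compose[OF p(1) H],
            where L = "\<lambda>x. H (p x)"]) (simp_all only: p(2,3) HJ)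
    then show ?thesis by (auto simp: spectrum_def invertible_operator_def)
  qed
  moreover have "z ^ ?n \<notin> spectrum T" if z: "z \<notin> spectrum ?J"
  proof -
    obtain W where W: "bounded_inverse (\<lambda>x. ?J x - z *\<^sub>C x) W"
      using z by (auto simp: spectrum_def invertible_operator_def)
    \<comment> \<open>The entry in the first row and last column of \<open>W\<close>. If
      \<open>(J - z) x\<close> is \<open>b\<close> in the last copy, then each coordinate of
      \<open>x\<close> is \<open>z\<close> times the previous one, and the last equation becomes
      \<open>(T - z ^ n) x_1 = b\<close>.\<close>
    define G where "G b = W (axis (index_at ?n) b) $ index_at 1" for b
    have "bounded_clinear G"
      unfolding G_def
      by (rule bounded_clinear_compose[OF bounded_clinear_nth
            bounded_clinear_compose[OF bounded_inverseD(2)[OF W] bounded_clinear_axis]])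
    moreover have "T (G b) - (z ^ ?n) *\<^sub>C G b = b" for b
    proof -
      define x where "x = W (axis (index_at ?n) b)"
      have x: "?J x - z *\<^sub>C x = axis (index_at ?n) b"
        by (simp add: x_def bounded_inverseD(4)[OF W])
      have coord: "?J x $ index_at k - z *\<^sub>C (x $ index_at k)
          = (axis (index_at ?n) b :: ('a, 'n) vec) $ index_at k" for k
        unfolding x[symmetric] by (simp add: scaleC_vec_def)
      have step: "x $ index_at (Suc k) = z *\<^sub>C (x $ index_at k)" if "1 \<le> k" "k < ?n" for k
        using coord[of k] that
        by (simp add: J_operator_index_at axis_def index_at_eq_iff Suc_leI)
      have "x $ index_at (Suc k) = (z ^ k) *\<^sub>C (x $ index_at 1)" if "k < ?n" for k
        using that by (induction k) (simp_all add: scaleC_one step scaleC_scaleC)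
      from this[of "?n - 1"] have "x $ index_at ?n = (z ^ (?n - 1)) *\<^sub>C (x $ index_at 1)" by simp
      then have "z *\<^sub>C (x $ index_at ?n) = (z ^ ?n) *\<^sub>C (x $ index_at 1)"
        by (simp add: scaleC_scaleC flip: power_Suc)
      then show ?thesis
        using coord[of ?n] by (simp add: J_operator_index_at G_def flip: x_def)
    qed
    moreover have "G (T a - (z ^ ?n) *\<^sub>C a) = a" for a
    proof -
      \<comment> \<open>The geometric vector \<open>(a, z a, ..., z ^ (n - 1) a)\<close>:
        \<open>J - z\<close> kills all its coordinates but the last.\<close>
      define x :: "('a, 'n) vec" where "x = (\<chi> i. (z ^ (position i - 1)) *\<^sub>C a)"
      have x: "x $ index_at k = (z ^ (k - 1)) *\<^sub>C a" if "1 \<le> k" "k \<le> ?n" for k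
        using that by (simp add: x_def position_index_at)
      have "?J x - z *\<^sub>C x = axis (index_at ?n) (T a - (z ^ ?n) *\<^sub>C a)"
      proof (rule vec_eq_index_atI)
        fix k assume k: "1 \<le> k" "k \<le> CARD('n)"
        show "(?J x - z *\<^sub>C x) $ index_at k
            = (axis (index_at ?n) (T a - (z ^ ?n) *\<^sub>C a) :: ('a, 'n) vec) $ index_at k"
        proof (cases "k = ?n")
          case True
          then show ?thesis
            by (simp add: scaleC_vec_def J_operator_index_at x Suc_leI scaleC_scaleC scaleC_one flip: power_Suc)
        next
          case False
          then show ?thesis
            using k by (simp add: scaleC_vec_def J_operator_index_at x axis_def index_at_eq_iff
                scaleC_scaleC Suc_leI flip: power_Suc)
        qed
      qed
      then have "G (T a - (z ^ ?n) *\<^sub>C a) = x $ index_at 1"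
        by (metis G_def bounded_inverseD(3)[OF W])
      then show ?thesis by (simp add: x Suc_leI scaleC_one)
    qed
    ultimately have "bounded_inverse (\<lambda>x. T x - (z ^ ?n) *\<^sub>C x) G"
      by (intro bounded_inverseI[where L = G] bounded_clinear_sub_scale T)
    then show ?thesis by (auto simp: spectrum_def invertible_operator_def)
  qed
  ultimately show ?thesis by blast
qed

lemma spectrum_similar:
  assumes S: "bounded_inverse S S'" and Y: "Y = S' \<circ> X \<circ> S"
  shows "spectrum X = spectrum Y"
proof -
  note S_simps = bounded_inverseD(3,4)[OF S]
  have S': "bounded_inverse S' S" using S by (auto simp: bounded_inverse_def)
  have inv: "invertible_operator S" "invertible_operator S'"
    using S S' by (auto simp: invertible_operator_def)
  have "(\<lambda>x. Y x - z *\<^sub>C x) = (\<lambda>x. S' (X (S x) - z *\<^sub>C S x))"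
    "(\<lambda>x. X x - z *\<^sub>C x) = (\<lambda>x. S (Y (S' x) - z *\<^sub>C S' x))" for z
    by (simp_all add: fun_eq_iff Y S_simps bounded_clinear_diff[OF bounded_inverseD(1)[OF S]]
        bounded_clinear_diff[OF bounded_inverseD(2)[OF S]]
        bounded_clinear_scaleC[OF bounded_inverseD(1)[OF S]]
        bounded_clinear_scaleC[OF bounded_inverseD(2)[OF S]])
  then have "invertible_operator (\<lambda>x. X x - z *\<^sub>C x) \<longleftrightarrow> invertible_operator (\<lambda>x. Y x - z *\<^sub>C x)" for z
    using invertible_operator_compose[OF inv(2)
        invertible_operator_compose[OF _ inv(1), of "\<lambda>x. X x - z *\<^sub>C x"]]
      invertible_operator_compose[OF inv(1)
        invertible_operator_compose[OF _ inv(2), of "\<lambda>x. Y x - z *\<^sub>C x"]] by auto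
  then show ?thesis by (simp add: spectrum_def)
qed

section \<open>Consequences of similarity to \<open>J_operator T\<close> for the spectrum\<close>

locale J_stable =
  fixes T :: "'a::complex_hilbert \<Rightarrow> 'a"
    and S :: "('a, 'n::{finite,linorder}) vec \<Rightarrow> 'a" and S' :: "'a \<Rightarrow> ('a, 'n) vec"
  assumes T: "bounded_clinear T" and card: "2 \<le> CARD('n)"
    and S: "bounded_inverse S S'" and J_eq: "J_operator T = S' \<circ> T \<circ> S"
begin

abbreviation J :: "('a, 'n) vec \<Rightarrow> ('a, 'n) vec" where "J \<equiv> J_operator T"
abbreviation last_copy :: "'a \<Rightarrow> ('a, 'n) vec" where "last_copy \<equiv> axis (index_at CARD('n))"

lemma bounded_clinear_J: "bounded_clinear J"
  using bounded_clinear_compose[OF bounded_inverseD(2)[OF S]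
      bounded_clinear_compose[OF T bounded_inverseD(1)[OF S]]]
  by (simp add: J_eq comp_def)

lemma mem_spectrum_iff_power: "z \<in> spectrum T \<longleftrightarrow> z ^ CARD('n) \<in> spectrum T"
  using spectrum_J_operator[OF T bounded_clinear_J] spectrum_similar[OF S J_eq] by simp

lemma mem_spectrum_iff_iterated_power: "z \<in> spectrum T \<longleftrightarrow> z ^ (CARD('n) ^ k) \<in> spectrum T"
  by (induction k arbitrary: z) (use mem_spectrum_iff_power in \<open>auto simp: power_mult mult.commute\<close>)

lemma closed_spectrum: "closed (spectrum T)"
  using open_resolvent_set[OF T] by (simp add: closed_def)

lemma spectrum_rotation_invariant: "z \<in> spectrum T \<Longrightarrow> cmod w = cmod z \<Longrightarrow> w \<in> spectrum T"
  using power_invariant_imp_rotation_invariant[OF card closed_spectrum mem_spectrum_iff_power] .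

text \<open>Iterated powers of a spectral point outside the disc would stay in the spectrum and
  exceed any bound \<open>K\<close> of \<open>T\<close>.\<close>

lemma spectrum_subset_cball: "spectrum T \<subseteq> cball 0 1"
proof
  fix z assume z: "z \<in> spectrum T"
  obtain K where K: "K > 0" "\<And>x. norm (T x) \<le> K * norm x"
    using bounded_clinear_bound[OF T] by blast
  have "cmod z \<le> 1"
  proof (rule ccontr)
    assume "\<not> cmod z \<le> 1"
    then obtain k where k: "K < cmod z ^ k" using real_arch_pow[of "cmod z" K] by auto
    also have "\<dots> \<le> cmod z ^ (CARD('n) ^ k)"
      using \<open>\<not> cmod z \<le> 1\<close> card less_exp[of k] power_mono[OF card, of k]
      by (intro power_increasing) auto
    finally have "z ^ (CARD('n) ^ k) \<notin> spectrum T"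
      using K by (intro spectrum_bounded[OF T K(2)]) (auto simp: norm_power)
    then show False using z mem_spectrum_iff_iterated_power by blast
  qed
  then show "z \<in> cball 0 1" by simp
qed

section \<open>Lifting orbits of \<open>T\<close> through the similarity\<close>

lemma T_S: "(T ^^ m) (S x) = S ((J ^^ m) x)"
  by (induction m) (simp_all add: J_eq bounded_inverseD(4)[OF S])

lemma funpow_J_last_copy: "(J ^^ (CARD('n) * q)) (last_copy v) = last_copy ((T ^^ q) v)"
proof (induction q)
  case (Suc q)
  have "(J ^^ (CARD('n) * Suc q)) (last_copy v) = (J ^^ CARD('n)) (last_copy ((T ^^ q) v))"
    by (simp add: funpow_add Suc)
  also have "\<dots> = last_copy ((T ^^ Suc q) v)"
    by (simp add: funpow_J_operator axis_def vec_eq_iff bounded_clinear_0[OF T])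
  finally show ?case .
qed simp

text \<open>The identity block in the last column copies \<open>v\<close> unchanged to the
  coordinate before the last, which exists because there are at least two.\<close>

lemma norm_J_last_copy_ge: "norm v \<le> norm (J (last_copy v))"
proof -
  have "J (last_copy v) $ index_at (CARD('n) - 1) = v"
    using card by (subst J_operator_index_at) auto
  then show ?thesis by (metis Finite_Cartesian_Product.norm_nth_le)
qed

lemma S_last_copy_eq_0_iff: "S (last_copy v) = 0 \<longleftrightarrow> v = 0"
proof
  assume "S (last_copy v) = 0"
  then have "last_copy v = 0"
    using bounded_inverseD(3)[OF S, of "last_copy v"] bounded_clinear_0[OF bounded_inverseD(2)[OF S]]
    by simp
  then show "v = 0" using norm_axis[of "index_at CARD('n)" v] by simp
next
  have "last_copy 0 = 0" by (rule bounded_clinear_0[OF bounded_clinear_axis])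
  moreover assume "v = 0"
  ultimately show "S (last_copy v) = 0" by (simp only: bounded_clinear_0[OF bounded_inverseD(1)[OF S]])
qed

text \<open>On the last copy, \<open>CARD('n)\<close> steps of \<open>J\<close> amount to one step
  of \<open>T\<close> on \<open>v\<close>, so the decay per step weakens to its
  \<open>CARD('n)\<close>-th root.\<close>

lemma S_last_copy_in_growth_space:
  assumes r: "0 < r" "r \<le> 1" and v: "v \<in> growth_space T (r ^ CARD('n))"
  shows "S (last_copy v) \<in> growth_space T r"
proof -
  let ?n = "CARD('n)"
  obtain B where B: "B > 0" "\<And>x. norm (J x) \<le> B * norm x"
    using bounded_clinear_bound[OF bounded_clinear_J] by blast
  obtain C where C: "C > 0" "\<And>x. norm (S x) \<le> C * norm x"
    using bounded_clinear_bound[OF bounded_inverseD(1)[OF S]] by blast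
  obtain K where K: "\<And>m. norm ((T ^^ m) v) \<le> K * (r ^ ?n) ^ m"
    using v by (auto simp: growth_space_def)
  have "0 \<le> K" using order.trans[OF norm_ge_zero K[of 0]] by simp
  \<comment> \<open>With \<open>b\<close> at least 1, \<open>b ^ p\<close> is at most
    \<open>b ^ ?n\<close> for every remainder \<open>p\<close>.\<close>
  define b where "b = max 1 B"
  have J_pow: "norm ((J ^^ p) x) \<le> b ^ p * norm x" for p x
  proof (induction p)
    case (Suc p)
    have "norm ((J ^^ Suc p) x) \<le> b * norm ((J ^^ p) x)"
      using B(2)[of "(J ^^ p) x"] mult_right_mono[of B b "norm ((J ^^ p) x)"] by (simp add: b_def)
    also have "\<dots> \<le> b * (b ^ p * norm x)" using Suc by (intro mult_left_mono) (auto simp: b_def)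
    finally show ?case by simp
  qed simp
  have "norm ((T ^^ m) (S (last_copy v))) \<le> (C * b ^ ?n * K * (1 / r) ^ ?n) * r ^ m" for m
  proof -
    define p q where "p = m mod ?n" and "q = m div ?n"
    have m: "m = p + ?n * q" "p \<le> ?n" by (simp_all add: p_def q_def less_imp_le)
    have "norm ((T ^^ m) (S (last_copy v))) \<le> C * norm ((J ^^ m) (last_copy v))"
      by (simp add: T_S C)
    also have "norm ((J ^^ m) (last_copy v)) \<le> b ^ p * norm ((T ^^ q) v)"
      using J_pow[of p "last_copy ((T ^^ q) v)"] by (simp add: m(1) funpow_add funpow_J_last_copy norm_axis)
    also have "\<dots> \<le> b ^ ?n * (K * (r ^ ?n) ^ q)"
      using m(2) K by (intro mult_mono power_increasing) (auto simp: b_def)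
    also have "(r ^ ?n) ^ q = (1 / r) ^ p * r ^ m"
      using r(1) by (simp add: m(1) power_add field_simps flip: power_mult)
    also have "b ^ ?n * (K * \<dots>) \<le> b ^ ?n * (K * ((1 / r) ^ ?n * r ^ m))"
      using r m(2) \<open>0 \<le> K\<close> by (intro mult_left_mono mult_right_mono power_increasing) (auto simp: b_def)
    finally show ?thesis using C(1) by (simp add: mult_ac)
  qed
  then show ?thesis unfolding growth_space_def by blast
qed

text \<open>Each lift multiplies the time by \<open>CARD('n)\<close> but costs only one factor
  \<open>C\<close>, the product of bounds for \<open>S\<close> and \<open>S'\<close>. The first lift
  starts at time 1, where an identity block prevents decay.\<close>

lemma slowly_decaying_vector:
  obtains C where "C > 0" "\<And>r j. 0 < r \<Longrightarrow> r \<le> 1 \<Longrightarrow>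
    \<exists>v\<in>growth_space T (r ^ (CARD('n) ^ Suc j)). v \<noteq> 0 \<Longrightarrow>
    \<exists>x\<in>growth_space T r. x \<noteq> 0 \<and> norm x \<le> C ^ Suc j * norm ((T ^^ (CARD('n) ^ j)) x)"
proof -
  let ?n = "CARD('n)"
  obtain K where K: "K > 0" "\<And>x. norm (S x) \<le> K * norm x"
    using bounded_clinear_bound[OF bounded_inverseD(1)[OF S]] by blast
  obtain K' where K': "K' > 0" "\<And>x. norm (S' x) \<le> K' * norm x"
    using bounded_clinear_bound[OF bounded_inverseD(2)[OF S]] by blast
  have S_ge: "norm x \<le> K' * norm (S x)" for x
    using K'(2)[of "S x"] by (simp add: bounded_inverseD(3)[OF S])
  have transfer: "norm (S (last_copy v)) \<le> c * (K * K') * norm ((T ^^ m) (S (last_copy v)))"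
    if "norm v \<le> c * norm ((J ^^ m) (last_copy v))" "c \<ge> 0" for v c m
  proof -
    have "norm (S (last_copy v)) \<le> K * norm v" using K(2)[of "last_copy v"] by (simp add: norm_axis)
    also have "\<dots> \<le> K * (c * (K' * norm (S ((J ^^ m) (last_copy v)))))"
      by (rule mult_left_mono[OF order.trans[OF that(1) mult_left_mono[OF S_ge that(2)]]])
        (use K in simp)
    finally show ?thesis by (simp add: T_S mult_ac)
  qed
  have "\<exists>x\<in>growth_space T r. x \<noteq> 0 \<and> norm x \<le> (K * K') ^ Suc j * norm ((T ^^ (?n ^ j)) x)"
    if "0 < r" "r \<le> 1" "\<exists>v\<in>growth_space T (r ^ (?n ^ Suc j)). v \<noteq> 0" for r j
    using that
  \<comment> \<open>The rate must vary: the vector to be lifted to rate \<open>r\<close> comes from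
    the induction hypothesis at \<open>r ^ ?n\<close>.\<close>
  proof (induction j arbitrary: r)
    case 0
    then obtain v where v: "v \<in> growth_space T (r ^ ?n)" "v \<noteq> 0" by auto
    have "norm (S (last_copy v)) \<le> (K * K') ^ Suc 0 * norm ((T ^^ (?n ^ 0)) (S (last_copy v)))"
      using transfer[of v 1 1] norm_J_last_copy_ge[of v] by simp
    then show ?case
      using S_last_copy_in_growth_space[OF 0(1,2) v(1)] v(2) S_last_copy_eq_0_iff by blast
  next
    case (Suc j)
    have "\<exists>v\<in>growth_space T ((r ^ ?n) ^ (?n ^ Suc j)). v \<noteq> 0"
      using Suc.prems(3) by (simp only: power_Suc[of _ "Suc j"] power_mult)
    then obtain v where v: "v \<in> growth_space T (r ^ ?n)" "v \<noteq> 0"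
      "norm v \<le> (K * K') ^ Suc j * norm ((T ^^ (?n ^ j)) v)"
      using Suc.IH[of "r ^ ?n"] Suc.prems(1,2) by (auto simp: power_le_one)
    have "norm (S (last_copy v)) \<le> (K * K') ^ Suc j * (K * K') * norm ((T ^^ (?n ^ Suc j)) (S (last_copy v)))"
    proof (rule transfer)
      show "norm v \<le> (K * K') ^ Suc j * norm ((J ^^ ?n ^ Suc j) (last_copy v))"
        using v(3) funpow_J_last_copy[of "?n ^ j" v] by (simp add: norm_axis)
      show "0 \<le> (K * K') ^ Suc j" using K(1) K'(1) by simp
    qed
    then show ?case
      using S_last_copy_in_growth_space[OF Suc.prems(1,2) v(1)] v(2) S_last_copy_eq_0_iff
      by (metis power_Suc2)
  qed
  then show ?thesis using that[of "K * K'"] K(1) K'(1) by auto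
qed

text \<open>Ratio test: the exponent grows by at least \<open>CARD('n) ^ j\<close>, hence by at
  least \<open>j\<close>, so consecutive terms have ratio at most \<open>C * s ^ j\<close>.\<close>

lemma powers_tendsto_0:
  fixes C s :: real
  assumes "0 < s" "s < 1" "0 < C"
  shows "(\<lambda>j. C ^ Suc j * s ^ (CARD('n) ^ j)) \<longlonglongrightarrow> 0"
proof -
  let ?n = "CARD('n)"
  have "(\<lambda>j. C * s ^ j) \<longlonglongrightarrow> 0"
    using assms by (intro tendsto_mult_right_zero LIMSEQ_power_zero) simp
  then have "\<forall>\<^sub>F j in sequentially. C * s ^ j < 1 / 2"
    by (rule order_tendstoD) simp
  then obtain N where N: "\<And>j. j \<ge> N \<Longrightarrow> C * s ^ j < 1 / 2"
    by (auto simp: eventually_sequentially)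
  have "summable (\<lambda>j. C ^ Suc j * s ^ (?n ^ j))"
  proof (rule summable_ratio_test[where N = N and c = "1 / 2"])
    fix j assume j: "N \<le> j"
    have "2 * ?n ^ j \<le> ?n ^ Suc j" using card by simp
    then have "j + ?n ^ j \<le> ?n ^ Suc j"
      using power_gt_expt[of ?n j] card by linarith
    then have "s ^ (?n ^ Suc j) \<le> s ^ (j + ?n ^ j)"
      using assms by (intro power_decreasing) auto
    then have "C ^ Suc (Suc j) * s ^ (?n ^ Suc j) \<le> C ^ Suc (Suc j) * s ^ (j + ?n ^ j)"
      using assms by (intro mult_left_mono) auto
    also have "\<dots> = (C * s ^ j) * (C ^ Suc j * s ^ (?n ^ j))" by (simp add: power_add)
    also have "\<dots> \<le> 1 / 2 * (C ^ Suc j * s ^ (?n ^ j))"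
      using N[OF j] assms by (intro mult_right_mono) auto
    finally show "norm (C ^ Suc (Suc j) * s ^ (?n ^ Suc j)) \<le> 1 / 2 * norm (C ^ Suc j * s ^ (?n ^ j))"
      using assms by (simp add: abs_mult)
  qed simp
  then show ?thesis by (rule summable_LIMSEQ_zero)
qed

lemma punctured_disc_subset_spectrum:
  assumes "\<not> invertible_operator T" and z: "0 < cmod z" "cmod z < 1"
  shows "z \<in> spectrum T"
proof (rule ccontr)
  let ?n = "CARD('n)" and ?s = "cmod z"
  assume z_notin: "z \<notin> spectrum T"
  \<comment> \<open>Power invariance carries the gap at \<open>z\<close> to its iterated powers, and
    rotation invariance spreads each of them over a circle.\<close>
  have disj: "sphere 0 (?s ^ (?n ^ k)) \<inter> spectrum T = {}" for k
  proof -
    have "z ^ (?n ^ k) \<notin> spectrum T" using z_notin mem_spectrum_iff_iterated_power by blast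
    then have "u \<notin> spectrum T" if "cmod u = ?s ^ (?n ^ k)" for u
      using spectrum_rotation_invariant[of u "z ^ (?n ^ k)"] that by (auto simp: norm_power)
    then show ?thesis by auto
  qed
  obtain M where M: "M > 0"
    "\<And>r x m. 0 \<le> r \<Longrightarrow> r < ?s \<Longrightarrow> x \<in> growth_space T r \<Longrightarrow> norm ((T ^^ m) x) \<le> M * ?s ^ m * norm x"
    using norm_funpow_growth_space_le[OF T z(1)] disj[of 0] by auto
  obtain C where C: "C > 0" "\<And>r j. 0 < r \<Longrightarrow> r \<le> 1 \<Longrightarrow>
    \<exists>v\<in>growth_space T (r ^ (?n ^ Suc j)). v \<noteq> 0 \<Longrightarrow>
    \<exists>x\<in>growth_space T r. x \<noteq> 0 \<and> norm x \<le> C ^ Suc j * norm ((T ^^ (?n ^ j)) x)"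
    using slowly_decaying_vector by metis
  \<comment> \<open>The lower bound from the lifts meets the uniform upper bound \<open>M\<close>.
    The lifted vector is taken at rate \<open>?s ^ ?n\<close>, strictly below \<open>?s\<close> as
    the upper bound demands; its \<open>j + 1\<close> lifts start at rate
    \<open>?s ^ (?n ^ (j + 2))\<close>.\<close>
  have "1 \<le> M * (C ^ Suc j * ?s ^ (?n ^ j))" for j
  proof -
    have "\<exists>v\<in>growth_space T ((?s ^ ?n) ^ (?n ^ Suc j)). v \<noteq> 0"
      using growth_space_nontrivial[OF T _ disj[of "Suc (Suc j)"] assms(1)] z(1)
      by (simp add: power_mult)
    then obtain x where x: "x \<in> growth_space T (?s ^ ?n)" "x \<noteq> 0"
      "norm x \<le> C ^ Suc j * norm ((T ^^ (?n ^ j)) x)"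
      using C(2)[of "?s ^ ?n" j] z by (auto simp: power_le_one)
    have "?s ^ ?n < ?s ^ 1" using z card by (intro power_strict_decreasing) auto
    then have "norm ((T ^^ (?n ^ j)) x) \<le> M * ?s ^ (?n ^ j) * norm x"
      using x(1) by (intro M(2)) auto
    then have "C ^ Suc j * norm ((T ^^ (?n ^ j)) x) \<le> C ^ Suc j * (M * ?s ^ (?n ^ j) * norm x)"
      using C(1) by (intro mult_left_mono) auto
    with x(3) have le: "1 * norm x \<le> (M * (C ^ Suc j * ?s ^ (?n ^ j))) * norm x"
      by (simp add: mult_ac)
    show ?thesis using mult_right_le_imp_le[OF le] x(2) by simp
  qed
  moreover have "(\<lambda>j. M * (C ^ Suc j * ?s ^ (?n ^ j))) \<longlonglongrightarrow> 0"
    by (intro tendsto_mult_right_zero powers_tendsto_0 z C)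
  ultimately have "(1::real) \<le> 0" by (intro LIMSEQ_le_const) auto
  then show False by simp
qed

section \<open>The spectrum in the invertible and in the non-invertible case\<close>

lemma zero_in_spectrum_iff: "0 \<in> spectrum T \<longleftrightarrow> \<not> invertible_operator T"
  by (simp add: spectrum_def scaleC.zero_left)

text \<open>Iterated powers of a spectral point inside the disc would converge to 0, which the
  closed spectrum misses. Nonemptiness then gives one point of the circle and rotation invariance
  all others.\<close>

lemma spectrum_invertible:
  assumes "invertible_operator T" and x: "(x :: 'a) \<noteq> 0"
  shows "spectrum T = sphere 0 1"
proof -
  have 0: "0 \<notin> spectrum T" using assms zero_in_spectrum_iff by blast
  have sub: "spectrum T \<subseteq> sphere 0 1"
  proof
    fix z assume z: "z \<in> spectrum T"
    have "\<not> cmod z < 1"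
    proof
      assume "cmod z < 1"
      have "filterlim (\<lambda>k. CARD('n) ^ k) at_top sequentially"
        using card less_exp power_mono[OF card]
        by (intro filterlim_at_top_mono[OF filterlim_ident]) (auto intro!: always_eventually less_imp_le order.strict_trans2)
      then have "(\<lambda>k. z ^ (CARD('n) ^ k)) \<longlonglongrightarrow> 0"
        by (rule filterlim_compose[OF LIMSEQ_power_zero[OF \<open>cmod z < 1\<close>]])
      moreover have "z ^ (CARD('n) ^ k) \<in> spectrum T" for k
        using z mem_spectrum_iff_iterated_power by blast
      ultimately have "0 \<in> spectrum T"
        using closed_spectrum by (metis closed_sequentially)
      then show False using 0 by simp
    qed
    then show "z \<in> sphere 0 1" using z spectrum_subset_cball by fastforce
  qed
  moreover obtain z where "z \<in> spectrum T" using spectrum_nonempty[OF T x] by blast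
  ultimately show ?thesis using spectrum_rotation_invariant[of z] by fastforce
qed

lemma spectrum_not_invertible:
  assumes "\<not> invertible_operator T"
  shows "spectrum T = closure (ball 0 1)"
proof
  show "spectrum T \<subseteq> closure (ball 0 1)" using spectrum_subset_cball by simp
  have "ball 0 1 \<subseteq> spectrum T"
  proof
    fix z :: complex assume "z \<in> ball 0 1"
    then show "z \<in> spectrum T"
      using punctured_disc_subset_spectrum[OF assms, of z] zero_in_spectrum_iff assms
      by (cases "z = 0") auto
  qed
  then show "closure (ball 0 1) \<subseteq> spectrum T" by (rule closure_minimal[OF _ closed_spectrum])
qed

end

theorem proposition2p9:
  fixes T :: "'a::complex_hilbert \<Rightarrow> 'a"
  assumes "separable_space (euclidean :: 'a topology)"
    and "infinite_dimensional TYPE('a)"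
    and "bounded_clinear T"
    and "2 \<le> CARD('n::{finite,linorder})"
    and "similar_operators T (J_operator T :: ('a, 'n) vec \<Rightarrow> ('a, 'n) vec)"
  shows "(invertible_operator T \<longrightarrow> spectrum T = sphere 0 1) \<and>
         (\<not> invertible_operator T \<longrightarrow> spectrum T = closure (ball 0 1))"
proof -
  obtain S :: "('a, 'n) vec \<Rightarrow> 'a" and S' where
    "bounded_inverse S S'" "(J_operator T :: ('a, 'n) vec \<Rightarrow> ('a, 'n) vec) = S' \<circ> T \<circ> S"
    using assms(5) unfolding similar_operators_def by blast
  then interpret J_stable T S S'
    using assms(3,4) by unfold_locales
  \<comment> \<open>A nonzero vector makes the spectrum nonempty; the zero space is excluded because
    the empty set spans it.\<close>
  have "\<exists>x :: 'a. x \<noteq> 0"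
  proof (rule ccontr)
    assume "\<nexists>x :: 'a. x \<noteq> 0"
    then have "module.span scaleC {} = (UNIV :: 'a set)" by (auto simp: scaleC.span_empty)
    then show False using assms(2) unfolding infinite_dimensional_def by blast
  qed
  then show ?thesis using spectrum_invertible spectrum_not_invertible by blast
qed

end
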